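(* Let $c\ge 0$, let $f\in W^{1,1}_{c,0}(0,\infty)$ with $f\neq 0$, put $M_f=\|f\|_{W^{1,1}_c(0,\infty)}$ and $\varepsilon=\|Lf\|_{L^\infty(c,\infty)}$, where $Lf$ is the Laplace transform of $f$ restricted to the real half-line $(c,\infty)$. Then $$\|f\|_{L^2_{c+1}(0,\infty)}\le 2(3+c)\,M_f\,\frac{1}{\left|\ln\left(\frac{\varepsilon}{M_f}\right)\right|^{1/4}}.$$
   Context: For $c\ge 0$ and $q\ge1$, $L^q_c(0,\infty)=\{f : e^{-ct}f(t)\in L^q(0,\infty)\}$ with norm $\|f\|_{L^q_c(0,\infty)}=\|e^{-ct}f\|_{L^q(0,\infty)}$. The weighted Sobolev space $W^{1,1}_c(0,\infty)=\{f : e^{-ct}f(t)\in W^{1,1}(0,\infty)\}$ is endowed with the norm $\|f\|_{W^{1,1}_c(0,\infty)}=\|f\|_{L^1_c(0,\infty)}+\|f'\|_{L^1_c(0,\infty)}$, and $W^{1,1}_{c,0}(0,\infty)$ is the closure of $C_0^\infty(0,\infty)$ in $W^{1,1}_c(0,\infty)$. The Laplace transform is $Lf(z)=\int_0^\infty e^{-z\tau}f(\tau)\,d\tau$ for $\mathrm{Re}\,z>c$. When $\varepsilon=M_f$ the right-hand side is interpreted as $+\infty$. *)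

theory Defs
  imports "HOL-Analysis.Analysis" "HOL-Probability.Essential_Supremum"
begin

text \<open>
  Functions on \<open>(0,\<infinity>)\<close> are complex-valued and represented by total functions on the reals
  whose values outside \<open>(0,\<infinity>)\<close> are never used (test functions excepted: these are extended by
  zero). All norms take values in \<open>[0,\<infinity>]\<close>.
\<close>

definition ennreal_powr :: "ennreal \<Rightarrow> real \<Rightarrow> ennreal" where
  "ennreal_powr x p = (if x = \<infinity> then \<infinity> else ennreal (enn2real x powr p))"

text \<open>\<open>|ln x|\<close> on \<open>[0,\<infinity>]\<close>, with \<open>|ln 0| = |ln \<infinity>| = \<infinity>\<close> (unlike the library's \<open>ln 0 = 0\<close>).\<close>

definition ennreal_abs_ln :: "ennreal \<Rightarrow> ennreal" where
  "ennreal_abs_ln x = (if x = 0 \<or> x = \<infinity> then \<infinity> else ennreal \<bar>ln (enn2real x)\<bar>)"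

definition exp_weight :: "real \<Rightarrow> (real \<Rightarrow> complex) \<Rightarrow> real \<Rightarrow> complex" where
  "exp_weight c f = (\<lambda>t. of_real (exp (- c * t)) * f t)"

definition Lq_norm :: "real \<Rightarrow> (real \<Rightarrow> complex) \<Rightarrow> ennreal" where
  "Lq_norm q f =
     ennreal_powr (\<integral>\<^sup>+ t. ennreal (norm (f t) powr q) \<partial>lebesgue_on {0<..}) (1 / q)"

definition Lq_weighted_norm :: "real \<Rightarrow> real \<Rightarrow> (real \<Rightarrow> complex) \<Rightarrow> ennreal" where
  "Lq_weighted_norm q c f = Lq_norm q (exp_weight c f)"

definition Linf_norm_on :: "real set \<Rightarrow> (real \<Rightarrow> complex) \<Rightarrow> ennreal" where
  "Linf_norm_on S f = esssup (lebesgue_on S) (\<lambda>t. ennreal (norm (f t)))"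

definition L1_space :: "(real \<Rightarrow> complex) set" where
  "L1_space = {f \<in> borel_measurable (lebesgue_on {0<..}). Lq_norm 1 f < \<infinity>}"

text \<open>\<open>C\<^sub>0\<^sup>\<infinity>(0,\<infinity>)\<close>: all iterated derivatives exist, and the support is a compact subset of
  the open half-line.\<close>

definition test_functions :: "(real \<Rightarrow> complex) set" where
  "test_functions = {\<phi>.
     (\<forall>n t. ((\<lambda>g s. vector_derivative g (at s)) ^^ n) \<phi> differentiable (at t)) \<and>
     (\<exists>a b. 0 < a \<and> (\<forall>t. t \<notin> {a..b} \<longrightarrow> \<phi> t = 0))}"

definition locally_integrable :: "(real \<Rightarrow> complex) \<Rightarrow> bool" where
  "locally_integrable f \<longleftrightarrow> (\<forall>a b. 0 < a \<longrightarrow> f absolutely_integrable_on {a..b})"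

definition has_weak_derivative :: "(real \<Rightarrow> complex) \<Rightarrow> (real \<Rightarrow> complex) \<Rightarrow> bool" where
  "has_weak_derivative f h \<longleftrightarrow>
     locally_integrable f \<and> locally_integrable h \<and>
     (\<forall>\<phi>\<in>test_functions.
        (LINT t|lebesgue_on {0<..}. f t * vector_derivative \<phi> (at t)) =
        - (LINT t|lebesgue_on {0<..}. h t * \<phi> t))"

text \<open>Determined up to equality almost everywhere on \<open>(0,\<infinity>)\<close> if a weak derivative exists.\<close>

definition weak_derivative :: "(real \<Rightarrow> complex) \<Rightarrow> real \<Rightarrow> complex" where
  "weak_derivative f = (SOME h. has_weak_derivative f h)"

definition W11_space :: "(real \<Rightarrow> complex) set" where
  "W11_space = {f \<in> L1_space. \<exists>h \<in> L1_space. has_weak_derivative f h}"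

definition W11_weighted_space :: "real \<Rightarrow> (real \<Rightarrow> complex) set" where
  "W11_weighted_space c = {f. exp_weight c f \<in> W11_space}"

definition W11_weighted_norm :: "real \<Rightarrow> (real \<Rightarrow> complex) \<Rightarrow> ennreal" where
  "W11_weighted_norm c f = Lq_weighted_norm 1 c f + Lq_weighted_norm 1 c (weak_derivative f)"

text \<open>The closure of \<open>C\<^sub>0\<^sup>\<infinity>(0,\<infinity>)\<close> in the weighted Sobolev space.\<close>

definition W11_weighted_zero_space :: "real \<Rightarrow> (real \<Rightarrow> complex) set" where
  "W11_weighted_zero_space c = {f \<in> W11_weighted_space c.
     \<forall>e>0. \<exists>\<phi>\<in>test_functions. W11_weighted_norm c (\<lambda>t. f t - \<phi> t) < ennreal e}"

definition laplace_transform :: "(real \<Rightarrow> complex) \<Rightarrow> complex \<Rightarrow> complex" where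
  "laplace_transform f z = (LINT \<tau>|lebesgue_on {0<..}. exp (- z * of_real \<tau>) * f \<tau>)"

end

theory Submission
  imports Defs "HOL-Probability.Probability" "HOL-Complex_Analysis.Complex_Analysis"
begin

text \<open>
  The proof has an analytic core for smooth functions and a limit argument.

  For a test function \<open>\<phi>\<close>, put \<open>\<Phi>(z) = \<integral> e\<^bsup>-zt\<^esup> \<phi>(t) dt\<close>, an entire function, and let
  \<open>m\<close> bound the weighted norm of \<open>\<phi>\<close>. On \<open>Re z \<ge> c\<close> this gives \<open>|\<Phi>(z)| \<le> m\<close>, and also
  \<open>|z \<Phi>(z)| \<le> m\<close> because \<open>z \<Phi>(z)\<close> is the transform of \<open>\<phi>'\<close>. On the real half-line let \<open>|\<Phi>|\<close> be at
  most \<open>e\<close>, where \<open>e < m\<close>, and put \<open>L = ln (m/e)\<close>. The smallness on the real axis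
  propagates into the half-plane, as in Nevanlinna's two-constants theorem: \<open>ln |\<Phi>|\<close> is subharmonic,
  so at \<open>c + 1 + iy\<close> it lies below \<open>ln m - L h\<close> for every harmonic \<open>h\<close> that is at most \<open>1\<close> on the real
  side of a region and at most \<open>0\<close> on the rest of its boundary. A triangle of size \<open>S\<close> with a cubic
  harmonic polynomial gives \<open>h \<ge> 1/(4S)\<close> for \<open>|y| \<le> S/2\<close> (\<open>two_constants\<close>). By Plancherel
  (\<open>plancherel_le\<close>), \<open>2\<pi> \<parallel>\<phi>\<parallel>\<^sup>2\<close> in \<open>L\<^sup>2\<close> with weight \<open>c + 1\<close> is at most the integral of
  \<open>|\<Phi>(c + 1 + iy)|\<^sup>2\<close> over \<open>y\<close>. The part \<open>|y| \<le> R\<close> contributes at most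
  \<open>2 R m\<^sup>2 e\<^bsup>-L/(4R)\<^esup>\<close> (take \<open>S = 2R\<close>) and the rest at most \<open>2 m\<^sup>2/R\<close>; the choice
  \<open>R = \<surd>L\<close> makes both of order \<open>m\<^sup>2 L\<^bsup>-1/2\<^esup>\<close> (\<open>stability_smooth\<close>). The resulting constant
  \<open>36 = 6\<^sup>2\<close> for the square gives the factor \<open>6 \<le> 2 (3 + c)\<close>.

  A general \<open>f\<close> is approximated by test functions \<open>\<phi>\<^sub>n\<close>. The norm of \<open>f\<close> involves its weak
  derivative, so convergence of \<open>\<phi>\<^sub>n'\<close> to \<open>f'\<close> rests on existence and uniqueness of weak derivatives
  (\<open>has_weak_derivative_exp_weight\<close>, \<open>weak_derivative_unique\<close>); uniqueness is the fundamental lemma of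
  the calculus of variations, which needs explicit smooth bump functions. The norms of \<open>\<phi>\<^sub>n\<close> and
  their transforms exceed those of \<open>f\<close> by at most \<open>\<delta>\<^sub>n \<longlongrightarrow> 0\<close>, and Fatou's lemma transfers the estimate
  to \<open>f\<close> (\<open>stability_squared\<close>).
\<close>

section \<open>A Plancherel inequality\<close>

lemma cnj_borel_measurable [measurable]: "cnj \<in> borel_measurable borel"
  by (intro borel_measurable_continuous_onI continuous_intros)

text \<open>
  The integrand is dominated by the tensor product of two integrable functions, so the order of
  integration may be exchanged.
\<close>

lemma Fubini_bounded_kernel:
  fixes u v :: "real \<Rightarrow> complex" and k :: "real \<Rightarrow> real \<Rightarrow> complex"
  assumes u: "integrable lborel u" and v: "integrable lborel v"
    and k[measurable]: "case_prod k \<in> borel_measurable (borel \<Otimes>\<^sub>M borel)"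
    and bound: "\<And>x y. norm (k x y) \<le> 1"
  shows "(LINT y|lborel. v y * (LINT x|lborel. u x * k x y))
       = (LINT x|lborel. u x * (LINT y|lborel. v y * k x y))"
proof -
  have [measurable]: "u \<in> borel_measurable borel" "v \<in> borel_measurable borel"
    using u v by auto
  have m: "(\<lambda>(x, y). u x * v y * k x y) \<in> borel_measurable (lborel \<Otimes>\<^sub>M lborel)"
    by measurable
  have uv: "integrable (lborel \<Otimes>\<^sub>M lborel) (\<lambda>(x, y). u x * v y)"
    using u v by (intro lborel_pair.Fubini_integrable) (auto simp: norm_mult)
  have "integrable (lborel \<Otimes>\<^sub>M lborel) (\<lambda>(x, y). u x * v y * k x y)"
    by (rule Bochner_Integration.integrable_bound[OF uv m])
       (auto simp: norm_mult bound mult_left_le)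
  from lborel_pair.Fubini_integral[OF this]
  have "(LINT y|lborel. LINT x|lborel. u x * v y * k x y)
      = (LINT x|lborel. LINT y|lborel. u x * v y * k x y)" .
  moreover have "(LINT x|lborel. u x * v y * k x y) = v y * (LINT x|lborel. u x * k x y)" for y
    by (subst integral_mult_right_zero[symmetric]) (simp add: ac_simps)
  moreover have "(LINT y|lborel. u x * v y * k x y) = u x * (LINT y|lborel. v y * k x y)" for x
    by (subst integral_mult_right_zero[symmetric]) (simp add: ac_simps)
  ultimately show ?thesis by simp
qed

definition fourier :: "(real \<Rightarrow> complex) \<Rightarrow> real \<Rightarrow> complex" where
  "fourier g y = (LINT t|lborel. g t * iexp (- (y * t)))"

lemma norm_fourier_le: "norm (fourier g y) \<le> (LINT t|lborel. norm (g t))"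
  unfolding fourier_def by (rule order.trans[OF integral_norm_bound]) (simp add: norm_mult)

lemma fourier_measurable [measurable]:
  assumes [measurable]: "g \<in> borel_measurable borel"
  shows "fourier g \<in> borel_measurable borel"
  unfolding fourier_def by measurable

lemma gaussian_fourier:
  "(LINT v|lborel. std_normal_density v * iexp (v * x)) = complex_of_real (exp (- x\<^sup>2 / 2))"
proof -
  have "(LINT v|lborel. std_normal_density v * iexp (v * x))
     = (LINT v|lborel. std_normal_density v *\<^sub>R iexp (v * x))"
    by (simp add: scaleR_conv_of_real)
  also have "\<dots> = char std_normal_distribution x"
    unfolding char_def by (subst integral_density) (auto simp: ac_simps)
  finally show ?thesis by (simp add: char_std_normal_distribution)
qed

text \<open>
  With a Gaussian damping factor the energy of the Fourier transform is absolutely convergent for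
  any integrable \<open>g\<close>. Writing the square as a double integral over \<open>t\<close> and \<open>s\<close> and integrating the
  frequency first leaves the Gaussian's own transform as a convolution kernel.
\<close>

lemma gaussian_fourier_energy:
  fixes g :: "real \<Rightarrow> complex"
  assumes g: "integrable lborel g" and d: "\<delta> > 0"
  shows "complex_of_real (LINT v|lborel. std_normal_density v * (norm (fourier g (v / \<delta>)))\<^sup>2)
       = (LINT t|lborel. g t * (LINT s|lborel. cnj (g s) * exp (- ((s - t) / \<delta>)\<^sup>2 / 2)))"
proof -
  let ?n = "\<lambda>v. complex_of_real (std_normal_density v)"
  let ?k = "\<lambda>t v. iexp (- (v / \<delta> * t))"
  have [measurable]: "g \<in> borel_measurable borel" using g by auto
  have cg: "integrable lborel (\<lambda>s. cnj (g s))" using g by simp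
  have n: "integrable lborel ?n" by simp
  have cf: "cnj (fourier g y) = (LINT s|lborel. cnj (g s) * iexp (y * s))" for y
    unfolding fourier_def
    by (simp add: exp_cnj Bochner_Integration.integral_cnj[symmetric] del: integral_cnj)
  have nf: "integrable lborel (\<lambda>v. ?n v * cnj (fourier g (v / \<delta>)))"
  proof (rule Bochner_Integration.integrable_bound)
    show "integrable lborel (\<lambda>v. complex_of_real (LINT t|lborel. norm (g t)) * ?n v)" by simp
    show "AE v in lborel. norm (?n v * cnj (fourier g (v / \<delta>)))
        \<le> norm (complex_of_real (LINT t|lborel. norm (g t)) * ?n v)"
      by (intro AE_I2) (auto simp: norm_mult mult.commute
        intro!: mult_left_mono order.trans[OF norm_fourier_le])
  qed measurable
  have inner: "(LINT v|lborel. ?n v * cnj (fourier g (v / \<delta>)) * ?k t v)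
     = (LINT s|lborel. cnj (g s) * exp (- ((s - t) / \<delta>)\<^sup>2 / 2))" for t
  proof -
    have nk: "integrable lborel (\<lambda>v. ?n v * ?k t v)"
      by (rule Bochner_Integration.integrable_bound[OF n]) (auto simp: norm_mult)
    have gauss: "(LINT v|lborel. (?n v * ?k t v) * iexp (v / \<delta> * s))
        = exp (- ((s - t) / \<delta>)\<^sup>2 / 2)" for s
    proof -
      have "(?n v * ?k t v) * iexp (v / \<delta> * s) = ?n v * iexp (v * ((s - t) / \<delta>))" for v
        unfolding mult.assoc exp_add[symmetric]
        by (rule arg_cong[where f="\<lambda>x. ?n v * exp x"]) (simp add: field_simps diff_divide_distrib)
      then show ?thesis by (simp only: gaussian_fourier)
    qed
    have "(LINT v|lborel. ?n v * cnj (fourier g (v / \<delta>)) * ?k t v)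
        = (LINT v|lborel. (?n v * ?k t v) * (LINT s|lborel. cnj (g s) * iexp (v / \<delta> * s)))"
      by (simp only: cf ac_simps)
    also have "\<dots> = (LINT s|lborel. cnj (g s) * (LINT v|lborel. (?n v * ?k t v) * iexp (v / \<delta> * s)))"
      by (rule Fubini_bounded_kernel[OF cg nk]) measurable
    also have "\<dots> = (LINT s|lborel. cnj (g s) * exp (- ((s - t) / \<delta>)\<^sup>2 / 2))"
      by (simp only: gauss)
    finally show ?thesis .
  qed
  have "complex_of_real (LINT v|lborel. std_normal_density v * (norm (fourier g (v / \<delta>)))\<^sup>2)
      = (LINT v|lborel. ?n v * cnj (fourier g (v / \<delta>)) * fourier g (v / \<delta>))"
    unfolding integral_complex_of_real[symmetric]
    by (simp only: of_real_mult complex_norm_square ac_simps)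
  also have "\<dots> = (LINT v|lborel. ?n v * cnj (fourier g (v / \<delta>)) * (LINT t|lborel. g t * ?k t v))"
    by (simp only: fourier_def)
  also have "\<dots> = (LINT t|lborel. g t * (LINT v|lborel. ?n v * cnj (fourier g (v / \<delta>)) * ?k t v))"
    by (rule Fubini_bounded_kernel[OF g nf]) measurable
  also have "\<dots> = (LINT t|lborel. g t * (LINT s|lborel. cnj (g s) * exp (- ((s - t) / \<delta>)\<^sup>2 / 2)))"
    by (simp only: inner)
  finally show ?thesis .
qed

text \<open>
  As \<open>\<delta> \<longlongrightarrow> 0\<close> the normalised kernel of \<open>gaussian_fourier_energy\<close> is an approximate identity, so the
  damped energies converge to \<open>2\<pi> \<integral> |g|\<^sup>2\<close>; since the damping factor is at most \<open>1\<close>, each of them is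
  bounded by the undamped energy.
\<close>

lemma plancherel_le:
  fixes g :: "real \<Rightarrow> complex"
  assumes cont: "continuous_on UNIV g" and "\<forall>t. t \<notin> {a..b} \<longrightarrow> g t = 0"
    and int: "integrable lborel (\<lambda>y. (norm (fourier g y))\<^sup>2)"
  shows "(LINT t|lborel. (norm (g t))\<^sup>2) \<le> (LINT y|lborel. (norm (fourier g y))\<^sup>2) / (2 * pi)"
proof -
  have supp: "g t = 0" if "t \<notin> {a..b}" for t using assms(2) that by blast
  have [measurable]: "g \<in> borel_measurable borel"
    using cont by (rule borel_measurable_continuous_onI)
  have "compact (g ` {a..b})"
    by (intro compact_continuous_image continuous_on_subset[OF cont]) auto
  then obtain G where G: "\<And>t. t \<in> {a..b} \<Longrightarrow> norm (g t) \<le> G"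
    by (meson bounded_iff compact_imp_bounded image_eqI)
  define K where "K = max G 0"
  have K: "norm (g t) \<le> K" for t using G[of t] supp[of t] by (cases "t \<in> {a..b}") (auto simp: K_def)
  have g: "integrable lborel g"
  proof -
    have "set_integrable lborel {a..b} g"
      by (rule borel_integrable_atLeastAtMost') (rule continuous_on_subset[OF cont], simp)
    moreover have "(\<lambda>x. indicator {a..b} x *\<^sub>R g x) = g" using supp by (auto simp: indicator_def)
    ultimately show ?thesis by (simp add: set_integrable_def)
  qed
  \<comment> \<open>\<open>I \<delta> t\<close> is the average of \<open>cnj g\<close> near \<open>t\<close> against a Gaussian of width \<open>\<delta>\<close>.\<close>
  define I where "I \<delta> t = (LINT u|lborel. cnj (g (t + \<delta> * u)) * std_normal_density u)" for \<delta> t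
  have I_int: "integrable lborel (\<lambda>u. cnj (g (t + \<delta> * u)) * complex_of_real (std_normal_density u))" for \<delta> t
    by (rule Bochner_Integration.integrable_bound[where f="\<lambda>u. K * std_normal_density u"])
       (auto simp: norm_mult abs_mult intro!: mult_mono order.trans[OF K] abs_ge_self)
  have I_bd: "norm (I \<delta> t) \<le> K" for \<delta> t
  proof -
    have "norm (I \<delta> t) \<le> (LINT u|lborel. K * std_normal_density u)"
      unfolding I_def
      by (rule order.trans[OF integral_norm_bound], rule integral_mono)
         (use integrable_norm[OF I_int] in \<open>auto simp: norm_mult intro!: mult_right_mono K\<close>)
    then show ?thesis by (simp)
  qed
  have le: "norm (LINT t|lborel. g t * I \<delta> t) \<le> (LINT y|lborel. (norm (fourier g y))\<^sup>2) / (2 * pi)"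
    if d: "\<delta> > 0" for \<delta>
  proof -
    define X where "X = (LINT v|lborel. std_normal_density v * (norm (fourier g (v / \<delta>)))\<^sup>2)"
    have int': "integrable lborel (\<lambda>v. (norm (fourier g (v / \<delta>)))\<^sup>2)"
      using lborel_integrable_real_affine[OF int, of "1/\<delta>" 0] d by simp
    have X0: "0 \<le> X" unfolding X_def by (intro Bochner_Integration.integral_nonneg) auto
    have nb: "std_normal_density v \<le> 1 / sqrt (2 * pi)" for v
      unfolding std_normal_density_def by (simp add: field_simps)
    have "X \<le> (LINT v|lborel. 1 / sqrt (2 * pi) * (norm (fourier g (v / \<delta>)))\<^sup>2)"
      unfolding X_def
    proof (rule integral_mono)
      show "integrable lborel (\<lambda>v. std_normal_density v * (norm (fourier g (v / \<delta>)))\<^sup>2)"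
        by (rule Bochner_Integration.integrable_bound[where
             f="\<lambda>v. 1 / sqrt (2 * pi) * (norm (fourier g (v / \<delta>)))\<^sup>2"])
           (use int' in \<open>auto simp: abs_mult simp del: times_divide_eq_left intro!: mult_right_mono nb\<close>)
    qed (use int' in \<open>auto simp del: times_divide_eq_left intro!: mult_right_mono nb\<close>)
    also have "\<dots> = 1 / sqrt (2 * pi) * (LINT v|lborel. (norm (fourier g (v / \<delta>)))\<^sup>2)" by simp
    also have "(LINT v|lborel. (norm (fourier g (v / \<delta>)))\<^sup>2) = \<delta> * (LINT y|lborel. (norm (fourier g y))\<^sup>2)"
      using lborel_integral_real_affine[of "1/\<delta>" "\<lambda>y. (norm (fourier g y))\<^sup>2" 0] d
      by (simp add: field_simps)
    finally have Xle: "X \<le> \<delta> / sqrt (2 * pi) * (LINT y|lborel. (norm (fourier g y))\<^sup>2)" by simp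
    have inner: "(LINT s|lborel. cnj (g s) * exp (- ((s - t) / \<delta>)\<^sup>2 / 2)) = \<delta> * sqrt (2 * pi) * I \<delta> t" for t
    proof -
      have "(LINT s|lborel. cnj (g s) * exp (- ((s - t) / \<delta>)\<^sup>2 / 2))
          = \<delta> *\<^sub>R (LINT u|lborel. cnj (g (t + \<delta> * u)) * complex_of_real (exp (- u\<^sup>2 / 2)))"
        using lborel_integral_real_affine[of \<delta> "\<lambda>s. cnj (g s) * exp (- ((s - t) / \<delta>)\<^sup>2 / 2)" t] d
        by simp
      also have "(LINT u|lborel. cnj (g (t + \<delta> * u)) * complex_of_real (exp (- u\<^sup>2 / 2)))
         = (LINT u|lborel. sqrt (2 * pi) * (cnj (g (t + \<delta> * u)) * std_normal_density u))"
        by (rule Bochner_Integration.integral_cong) (auto simp: std_normal_density_def)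
      also have "\<dots> = sqrt (2 * pi) * I \<delta> t"
        unfolding I_def by (rule integral_mult_right_zero)
      finally show ?thesis by (simp add: scaleR_conv_of_real)
    qed
    have "complex_of_real X = (LINT t|lborel. g t * (LINT s|lborel. cnj (g s) * exp (- ((s - t) / \<delta>)\<^sup>2 / 2)))"
      unfolding X_def by (rule gaussian_fourier_energy[OF g d])
    also have "\<dots> = (LINT t|lborel. g t * (\<delta> * sqrt (2 * pi) * I \<delta> t))"
      by (simp only: inner)
    also have "\<dots>
        = \<delta> * sqrt (2 * pi) * (LINT t|lborel. g t * I \<delta> t)"
      by (subst integral_mult_right_zero[symmetric]) (simp add: ac_simps)
    finally have "norm (complex_of_real X) = \<delta> * sqrt (2 * pi) * norm (LINT t|lborel. g t * I \<delta> t)"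
      using d by (simp add: norm_mult)
    then have "\<delta> * sqrt (2 * pi) * norm (LINT t|lborel. g t * I \<delta> t)
       \<le> \<delta> / sqrt (2 * pi) * (LINT y|lborel. (norm (fourier g y))\<^sup>2)"
      using Xle X0 by simp
    then have "(sqrt (2 * pi) * sqrt (2 * pi)) * norm (LINT t|lborel. g t * I \<delta> t)
       \<le> (LINT y|lborel. (norm (fourier g y))\<^sup>2)"
      using d by (simp add: field_simps del: real_sqrt_mult_self)
    then have "2 * pi * norm (LINT t|lborel. g t * I \<delta> t)
       \<le> (LINT y|lborel. (norm (fourier g y))\<^sup>2)"
      by simp
    then show ?thesis by (simp add: field_simps)
  qed
  have lim: "(\<lambda>k. LINT t|lborel. g t * I (1 / real (Suc k)) t) \<longlonglongrightarrow> (LINT t|lborel. g t * cnj (g t))"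
  proof (rule integral_dominated_convergence[where w="\<lambda>t. norm (g t) * K"])
    have "I (1 / real (Suc k)) \<in> borel_measurable borel" for k
      unfolding I_def by measurable
    then show "(\<lambda>t. g t * I (1 / real (Suc k)) t) \<in> borel_measurable lborel" for k by measurable
    show "AE t in lborel. (\<lambda>k. g t * I (1 / real (Suc k)) t) \<longlonglongrightarrow> g t * cnj (g t)"
    proof (intro AE_I2 tendsto_mult tendsto_const)
      fix t
      have "(\<lambda>k. I (1 / real (Suc k)) t) \<longlonglongrightarrow> (LINT u|lborel. cnj (g t) * std_normal_density u)"
        unfolding I_def
      proof (rule integral_dominated_convergence[where w="\<lambda>u. K * std_normal_density u"])
        show "AE u in lborel. (\<lambda>k. cnj (g (t + 1 / real (Suc k) * u)) * complex_of_real (std_normal_density u))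
           \<longlonglongrightarrow> cnj (g t) * complex_of_real (std_normal_density u)"
        proof (intro AE_I2 tendsto_mult tendsto_const tendsto_cnj)
          fix u
          have "(\<lambda>k. t + 1 / real (Suc k) * u) \<longlonglongrightarrow> t + 0 * u"
            by (intro tendsto_intros LIMSEQ_inverse_real_of_nat[unfolded inverse_eq_divide])
          then have "(\<lambda>k. t + 1 / real (Suc k) * u) \<longlonglongrightarrow> t" by simp
          then show "(\<lambda>k. g (t + 1 / real (Suc k) * u)) \<longlonglongrightarrow> g t"
            using cont continuous_on_tendsto_compose[OF cont] by simp
        qed
      qed (auto simp: norm_mult intro!: mult_right_mono K)
      also have "(LINT u|lborel. cnj (g t) * std_normal_density u) = cnj (g t)"
        by (subst integral_mult_right_zero) simp
      finally show "(\<lambda>k. I (1 / real (Suc k)) t) \<longlonglongrightarrow> cnj (g t)" .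
    qed
    show "AE t in lborel. norm (g t * I (1 / real (Suc k)) t) \<le> norm (g t) * K" for k
      by (auto simp: norm_mult intro!: mult_left_mono I_bd)
  qed (use g in auto)
  have "(LINT t|lborel. g t * cnj (g t)) = complex_of_real (LINT t|lborel. (norm (g t))\<^sup>2)"
    unfolding integral_complex_of_real[symmetric]
    by (simp only: complex_norm_square)
  moreover have "norm (LINT t|lborel. g t * cnj (g t)) \<le> (LINT y|lborel. (norm (fourier g y))\<^sup>2) / (2 * pi)"
    by (rule LIMSEQ_le_const2[OF tendsto_norm[OF lim]]) (use le in auto)
  ultimately show ?thesis by simp
qed

section \<open>Propagation of smallness in a half-plane\<close>

text \<open>
  The maximum principle for \<open>F z * exp (L * H z)\<close> on a triangle, in coordinates \<open>x = Re z - c\<close> and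
  \<open>y = Im z\<close> with sides \<open>x = 0\<close>, \<open>y = 0\<close> and \<open>x = \<surd>3 (S - y)\<close>. The harmonic function
  \<open>Re H = x (3 (S - y)\<^sup>2 - x\<^sup>2) / (2 S\<^sup>3)\<close> is a multiple of the real part of the cube of \<open>z - c - i S\<close>,
  so it vanishes on the lines through the apex \<open>c + i S\<close> that carry two of the sides. On the side
  \<open>y = 0\<close> it is at most \<open>1\<close>, with equality at \<open>x = S\<close>, and there the bound \<open>e\<close> for \<open>F\<close> compensates the
  factor \<open>exp L = m / e\<close>. A polynomial takes the place of the harmonic measure of a quadrant, whose
  jump at the vertex would require a Phragmen-Lindelof argument.
\<close>

lemma two_constants_upper:
  fixes F :: "complex \<Rightarrow> complex" and c m e S y :: real
  assumes F: "F holomorphic_on UNIV"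
    and bound: "\<And>z. c \<le> Re z \<Longrightarrow> norm (F z) \<le> m"
    and axis: "\<And>s. c \<le> s \<Longrightarrow> norm (F (of_real s)) \<le> e"
    and e: "0 < e" "e \<le> m" and S: "2 \<le> S" and y: "0 \<le> y" "y \<le> S / 2"
  shows "norm (F (Complex (c + 1) y)) \<le> m * exp (- (ln (m / e) / (4 * S)))"
proof -
  define L where "L = ln (m / e)"
  have L: "0 \<le> L" using e by (simp add: L_def)
  have eL: "e * exp L = m" using e by (simp add: L_def)
  define h where "h x y = x * (3 * (S - y)\<^sup>2 - x\<^sup>2) / (2 * S ^ 3)" for x y
  define H where "H z = - ((z - of_real c - \<i> * of_real S) ^ 3) / of_real (2 * S ^ 3)" for z :: complex
  have ReH: "Re (H z) = h (Re z - c) (Im z)" for z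
    unfolding H_def h_def Re_divide_of_real
    by (simp add: power3_eq_cube power2_eq_square algebra_simps)
  define D where "D = {z. c \<le> Re z \<and> 0 \<le> Im z \<and> Re z - c + sqrt 3 * Im z \<le> sqrt 3 * S}"
  define D' where "D' = {z. c < Re z \<and> 0 < Im z \<and> Re z - c + sqrt 3 * Im z < sqrt 3 * S}"
  have ImS: "Im z \<le> S" if "z \<in> D" for z
  proof -
    have "sqrt 3 * Im z \<le> sqrt 3 * S" using that unfolding D_def mem_Collect_eq by linarith
    then show ?thesis by simp
  qed
  have clD: "closed D"
    unfolding D_def by (intro closed_Collect_conj closed_Collect_le continuous_intros)
  have opD': "open D'"
    unfolding D'_def by (intro open_Collect_conj open_Collect_less continuous_intros)
  have "D' \<subseteq> D" by (auto simp: D_def D'_def)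
  then have D'int: "D' \<subseteq> interior D" using opD' by (rule interior_maximal)
  have bdD: "bounded D"
  proof (rule bounded_subset)
    show "bounded (cbox (Complex c 0) (Complex (c + sqrt 3 * S) S))" by (rule bounded_cbox)
    show "D \<subseteq> cbox (Complex c 0) (Complex (c + sqrt 3 * S) S)"
    proof
      fix z assume z: "z \<in> D"
      have "0 \<le> sqrt 3 * Im z" using z by (auto simp: D_def)
      then show "z \<in> cbox (Complex c 0) (Complex (c + sqrt 3 * S) S)"
        using z ImS[OF z] unfolding in_cbox_complex_iff D_def mem_Collect_eq complex.sel atLeastAtMost_iff
        by linarith
    qed
  qed
  define G where "G z = F z * exp (of_real L * H z)" for z
  have normG: "norm (G z) = norm (F z) * exp (L * h (Re z - c) (Im z))" for z
    by (simp add: G_def norm_mult ReH)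
  have G: "G holomorphic_on UNIV"
    unfolding G_def H_def using S by (intro holomorphic_intros F) auto
  have "norm (G (Complex (c + 1) y)) \<le> m"
  proof (rule maximum_modulus_frontier[where S=D and f=G])
    show "G holomorphic_on interior D" using G by (rule holomorphic_on_subset) simp
    show "continuous_on (closure D) G"
      using G holomorphic_on_imp_continuous_on continuous_on_subset by blast
    show "bounded D" by (rule bdD)
    have "1 + sqrt 3 * y \<le> sqrt 3 * S"
    proof -
      have "1 \<le> sqrt 3 * 1" by simp
      also have "\<dots> \<le> sqrt 3 * (S - y)" using y S by (intro mult_left_mono) auto
      finally show ?thesis by (simp add: algebra_simps)
    qed
    then show "Complex (c + 1) y \<in> D" using y by (auto simp: D_def)
    show "norm (G z) \<le> m" if "z \<in> frontier D" for z
    proof -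
      have zD: "z \<in> D" using that clD by (auto simp: frontier_def)
      have "z \<notin> D'" using that D'int by (auto simp: frontier_def)
      then consider "Re z = c" | "Im z = 0" | "Re z - c + sqrt 3 * Im z = sqrt 3 * S"
        using zD by (fastforce simp: D_def D'_def)
      then show ?thesis
      proof cases
        case 1
        then show ?thesis using bound[of z] by (simp add: normG h_def)
      next
        case 2
        then have "z = of_real (Re z)" by (simp add: complex_eq_iff)
        then have Fz: "norm (F z) \<le> e" using axis[of "Re z"] zD by (auto simp: D_def)
        define x where "x = Re z - c"
        have "0 \<le> x" using zD by (auto simp: x_def D_def)
        \<comment> \<open>The polynomial \<open>2 S\<^sup>3 - x (3 S\<^sup>2 - x\<^sup>2)\<close> has a double root at \<open>x = S\<close>.\<close>
        then have "0 \<le> (x - S)\<^sup>2 * (x + 2 * S)" using S by simp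
        then have "x * (3 * S\<^sup>2 - x\<^sup>2) \<le> 2 * S ^ 3"
          by (simp add: algebra_simps power2_eq_square power3_eq_cube)
        then have "h x 0 \<le> 1" using S by (simp add: h_def)
        then have "exp (L * h x 0) \<le> exp L" using L by (simp add: mult_left_le)
        then have "norm (G z) \<le> e * exp L"
          unfolding normG using 2 Fz e by (auto simp: x_def intro!: mult_mono)
        then show ?thesis by (simp add: eL)
      next
        case 3
        then have "Re z - c = sqrt 3 * (S - Im z)" by (simp add: algebra_simps)
        then have "h (Re z - c) (Im z) = 0" by (simp add: h_def power_mult_distrib)
        then show ?thesis using bound[of z] zD by (simp add: normG D_def)
      qed
    qed
  qed
  then have "norm (F (Complex (c + 1) y)) * exp (L * h 1 y) \<le> m" by (simp add: normG)
  then have "norm (F (Complex (c + 1) y)) \<le> m * exp (- (L * h 1 y))"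
    by (simp add: exp_minus field_simps)
  \<comment> \<open>\<open>h 1 y \<ge> 1 / (4 S)\<close>, since \<open>S - y \<ge> S / 2\<close> and \<open>S \<ge> 2\<close>.\<close>
  also have "\<dots> \<le> m * exp (- (L / (4 * S)))"
  proof -
    have "S\<^sup>2 / 4 \<le> (S - y)\<^sup>2"
    proof -
      have "(S / 2)\<^sup>2 \<le> (S - y)\<^sup>2" using y S by (intro power_mono) auto
      then show ?thesis by (simp add: power_divide)
    qed
    moreover have "2\<^sup>2 \<le> S\<^sup>2" using S by (intro power_mono) auto
    ultimately have "S\<^sup>2 / 2 \<le> 3 * (S - y)\<^sup>2 - 1" by simp
    then have "S\<^sup>2 / 2 / (2 * S ^ 3) \<le> h 1 y"
      unfolding h_def using S by (intro divide_right_mono) auto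
    also have "S\<^sup>2 / 2 / (2 * S ^ 3) = 1 / (4 * S)"
      using S by (simp add: power2_eq_square power3_eq_cube)
    finally have "L * (1 / (4 * S)) \<le> L * h 1 y" using L by (intro mult_left_mono)
    then show ?thesis using e by (auto intro!: mult_left_mono)
  qed
  finally show ?thesis by (simp add: L_def)
qed

text \<open>
  Points below the real axis are reached by reflection: \<open>cnj \<circ> F \<circ> cnj\<close> satisfies the same
  hypotheses as \<open>F\<close>.
\<close>

lemma two_constants:
  fixes F :: "complex \<Rightarrow> complex" and c m e S y :: real
  assumes F: "F holomorphic_on UNIV"
    and bound: "\<And>z. c \<le> Re z \<Longrightarrow> norm (F z) \<le> m"
    and axis: "\<And>s. c \<le> s \<Longrightarrow> norm (F (of_real s)) \<le> e"
    and e: "0 < e" "e \<le> m" and S: "2 \<le> S" and y: "\<bar>y\<bar> \<le> S / 2"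
  shows "norm (F (Complex (c + 1) y)) \<le> m * exp (- (ln (m / e) / (4 * S)))"
proof (cases "0 \<le> y")
  case True
  then show ?thesis using two_constants_upper[OF F bound axis e S] y by simp
next
  case False
  have "norm ((cnj \<circ> F \<circ> cnj) (Complex (c + 1) (- y))) \<le> m * exp (- (ln (m / e) / (4 * S)))"
  proof (rule two_constants_upper)
    show "cnj \<circ> F \<circ> cnj holomorphic_on UNIV"
      by (subst holomorphic_on_compose_cnj_cnj) (use F in auto)
  qed (use bound axis e S y False in auto)
  moreover have "cnj (Complex (c + 1) (- y)) = Complex (c + 1) y" by (simp add: complex_eq_iff)
  ultimately show ?thesis by simp
qed

section \<open>The Laplace transform of a smooth function with compact support\<close>

lemma continuous_compact_support_integrable:
  fixes f :: "real \<Rightarrow> 'a::euclidean_space"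
  assumes cont: "continuous_on UNIV f" and supp: "\<forall>t. t \<notin> {a..b} \<longrightarrow> f t = 0"
  shows "integrable lborel f" "(LINT t|lborel. f t) = integral {a..b} f"
proof -
  have eq: "(\<lambda>x. indicator {a..b} x *\<^sub>R f x) = f" using supp by (auto simp: indicator_def)
  have si: "set_integrable lborel {a..b} f"
    by (rule borel_integrable_atLeastAtMost') (rule continuous_on_subset[OF cont], simp)
  then show "integrable lborel f" using eq by (simp add: set_integrable_def)
  show "(LINT t|lborel. f t) = integral {a..b} f"
    using set_borel_integral_eq_integral(2)[OF si] eq by (simp add: set_lebesgue_integral_def)
qed

text \<open>
  The Laplace transform as a Borel integral over the whole line. It agrees with
  \<open>laplace_transform\<close> on continuous functions that vanish off \<open>(0,\<infinity>)\<close>.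
\<close>

definition laplace :: "(real \<Rightarrow> complex) \<Rightarrow> complex \<Rightarrow> complex" where
  "laplace f z = (LINT t|lborel. exp (- z * of_real t) * f t)"

lemma laplace_holomorphic:
  assumes cont: "continuous_on UNIV f" and supp: "\<forall>t. t \<notin> {a..b} \<longrightarrow> f t = 0"
  shows "laplace f holomorphic_on UNIV"
proof -
  have c: "continuous_on A f" for A using cont by (rule continuous_on_subset) simp
  have "laplace f = (\<lambda>z. integral (cbox a b) (\<lambda>t. exp (- z * of_real t) * f t))"
    unfolding laplace_def
    by (rule ext, subst continuous_compact_support_integrable(2)[where a=a and b=b])
       (auto intro!: continuous_intros cont simp: supp)
  moreover have "(\<lambda>z. integral (cbox a b) (\<lambda>t. exp (- z * of_real t) * f t)) holomorphic_on UNIV"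
    by (rule leibniz_rule_holomorphic[where fx="\<lambda>z t. - of_real t * exp (- z * of_real t) * f t"])
       (auto intro!: derivative_eq_intros continuous_intros c integrable_continuous_real
          continuous_on_compose2[OF cont] simp: case_prod_unfold)
  ultimately show ?thesis by simp
qed

text \<open>
  Integration by parts without boundary terms: \<open>exp (- z t) f' t - z exp (- z t) f t\<close> is the derivative
  of a function that vanishes at both ends.
\<close>

lemma laplace_deriv:
  assumes deriv: "\<And>t. (f has_vector_derivative f' t) (at t)" and cont: "continuous_on UNIV f'"
    and ab: "a \<le> b"
    and supp: "\<forall>t. t \<notin> {a<..<b} \<longrightarrow> f t = 0" "\<forall>t. t \<notin> {a<..<b} \<longrightarrow> f' t = 0"
  shows "laplace f' z = z * laplace f z"
proof -
  have contf: "continuous_on UNIV f"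
    using deriv by (meson continuous_at_imp_continuous_on has_vector_derivative_continuous)
  have D: "((\<lambda>t. exp (- z * of_real t) * f t) has_vector_derivative
      (exp (- z * of_real t) * f' t - z * (exp (- z * of_real t) * f t))) (at t within {a..b})" for t
  proof -
    have "((\<lambda>t. exp (- z * of_real t)) has_vector_derivative - z * exp (- z * of_real t)) (at t within {a..b})"
      by (rule has_vector_derivative_real_field) (auto intro!: derivative_eq_intros)
    from has_vector_derivative_mult[OF this has_vector_derivative_at_within[OF deriv, of t "{a..b}"]]
    show ?thesis by (simp add: algebra_simps)
  qed
  have i1: "integrable lborel (\<lambda>t. exp (- z * of_real t) * f' t)"
   and i2: "integrable lborel (\<lambda>t. exp (- z * of_real t) * f t)"
    by (rule continuous_compact_support_integrable(1)[where a=a and b=b];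
        force intro!: continuous_intros cont contf simp: supp)+
  have "laplace f' z - z * laplace f z
     = (LINT t|lborel. exp (- z * of_real t) * f' t - z * (exp (- z * of_real t) * f t))"
    unfolding laplace_def using i1 i2 by simp
  also have "\<dots> = integral {a..b} (\<lambda>t. exp (- z * of_real t) * f' t - z * (exp (- z * of_real t) * f t))"
    by (rule continuous_compact_support_integrable(2))
       (auto intro!: continuous_intros cont contf simp: supp)
  also have "\<dots> = exp (- z * of_real b) * f b - exp (- z * of_real a) * f a"
    by (intro integral_unique fundamental_theorem_of_calculus ab D)
  also have "\<dots> = 0" by (simp add: supp)
  finally show ?thesis by simp
qed

lemma norm_laplace_le:
  assumes f: "continuous_on UNIV f" "\<forall>t. t \<notin> {a..b} \<longrightarrow> f t = 0" and a: "0 \<le> a" and z: "c \<le> Re z"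
  shows "norm (laplace f z) \<le> (LINT t|lborel. exp (- c * t) * norm (f t))"
  unfolding laplace_def
proof (rule order.trans[OF integral_norm_bound], rule integral_mono)
  show "integrable lborel (\<lambda>t. norm (exp (- z * of_real t) * f t))"
   and "integrable lborel (\<lambda>t. exp (- c * t) * norm (f t))"
    by (rule continuous_compact_support_integrable(1)[where a=a and b=b];
        auto intro!: continuous_intros f simp: f(2))+
  show "norm (exp (- z * of_real t) * f t) \<le> exp (- c * t) * norm (f t)" for t
  proof (cases "t \<in> {a..b}")
    case True
    then have "c * t \<le> Re z * t" using z a by (intro mult_right_mono) auto
    then show ?thesis by (auto simp: norm_mult intro!: mult_right_mono)
  qed (simp add: f)
qed

lemma fourier_exp_weight:
  "fourier (\<lambda>t. of_real (exp (- x * t)) * f t) y = laplace f (Complex x y)"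
  unfolding fourier_def laplace_def
proof (rule Bochner_Integration.integral_cong[OF refl])
  fix t
  have "complex_of_real (exp (- x * t)) * iexp (- (y * t)) = exp (- Complex x y * of_real t)"
    unfolding exp_of_real[symmetric] exp_add[symmetric]
    by (rule arg_cong[where f=exp]) (simp add: complex_eq_iff)
  then show "complex_of_real (exp (- x * t)) * f t * iexp (- (y * t)) = exp (- Complex x y * of_real t) * f t"
    by (metis mult.commute mult.left_commute)
qed

section \<open>The estimate for smooth functions\<close>

lemma has_integral_inverse_square_tail:
  fixes R :: real
  assumes R: "0 < R"
  shows "has_bochner_integral lborel (\<lambda>y. 1 / y\<^sup>2 * indicator {R..} y) (1 / R)"
proof (rule has_bochner_integral_nn_integral)
  have "(\<integral>\<^sup>+y. ennreal (1 / y\<^sup>2) * indicator {R..} y \<partial>lborel) = ennreal (0 - (- (1 / R)))"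
  proof (rule nn_integral_FTC_atLeast[where F="\<lambda>y. - (1 / y)"])
    show "((\<lambda>y. - (1 / y)) has_real_derivative 1 / x\<^sup>2) (at x)" if "R \<le> x" for x
      using that R by (auto intro!: derivative_eq_intros simp: power2_eq_square)
    show "((\<lambda>y::real. - (1 / y)) \<longlongrightarrow> 0) at_top" by real_asymp
  qed auto
  then show "(\<integral>\<^sup>+y. ennreal (1 / y\<^sup>2 * indicator {R..} y) \<partial>lborel) = ennreal (1 / R)"
    by (simp add: indicator_mult_ennreal mult.commute)
qed (use R in auto)

text \<open>
  The frequency integral is split at \<open>|y| = R\<close>: a uniform bound near the origin, decay like \<open>1 / y\<^sup>2\<close>
  beyond.
\<close>

lemma integral_split_bound:
  fixes W :: "real \<Rightarrow> real"
  assumes [measurable]: "W \<in> borel_measurable borel" and W0: "\<And>y. 0 \<le> W y"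
    and R: "0 < R" and near: "\<And>y. \<bar>y\<bar> \<le> R \<Longrightarrow> W y \<le> k" and far: "\<And>y. y\<^sup>2 * W y \<le> K"
  shows "integrable lborel W" "(LINT y|lborel. W y) \<le> 2 * R * k + 2 * K / R"
proof -
  let ?t = "\<lambda>y::real. 1 / y\<^sup>2 * indicator {R..} y"
  let ?V = "\<lambda>y. k * indicator {- R..R} y + (K * ?t y + K * ?t (- y))"
  note t = has_integral_inverse_square_tail[OF R]
  have t': "has_bochner_integral lborel (\<lambda>y. ?t (- y)) (1 / R)"
    using t lborel_has_bochner_integral_real_affine_iff[of "-1" ?t "1 / R" 0] by simp
  have V: "has_bochner_integral lborel ?V (k * (2 * R) + (K * (1 / R) + K * (1 / R)))"
  proof (intro has_bochner_integral_add has_bochner_integral_mult_right t t')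
    show "has_bochner_integral lborel (indicator {- R..R}) (2 * R)"
      using R has_bochner_integral_real_indicator[of "{- R..R}" lborel] by simp
  qed
  have k: "0 \<le> k" using near[of 0] W0[of 0] R by simp
  have K: "0 \<le> K" using far[of 0] by simp
  have WV: "W y \<le> ?V y" for y
  proof (cases "\<bar>y\<bar> \<le> R")
    case True
    then have "y \<in> {- R..R}" by auto
    then show ?thesis using near[OF True] k K by (auto intro!: add_increasing2)
  next
    case False
    then have "W y \<le> K / y\<^sup>2" using far[of y] R by (simp add: field_simps)
    then show ?thesis using False k R by (auto simp: indicator_def)
  qed
  show i: "integrable lborel W"
  proof (rule Bochner_Integration.integrable_bound[OF integrable.intros[OF V]])
    have "norm (W y) \<le> norm (?V y)" for y
      unfolding real_norm_def using W0[of y] WV[of y] by linarith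
    then show "AE y in lborel. norm (W y) \<le> norm (?V y)" by (intro AE_I2)
  qed simp
  have "(LINT y|lborel. W y) \<le> (LINT y|lborel. ?V y)"
    by (intro integral_mono i WV) (use V in \<open>auto simp: has_bochner_integral_iff\<close>)
  also have "\<dots> = 2 * R * k + 2 * K / R"
    using has_bochner_integral_integral_eq[OF V] by (simp add: algebra_simps)
  finally show "(LINT y|lborel. W y) \<le> 2 * R * k + 2 * K / R" .
qed

lemma square_mult_exp_minus_le: "x\<^sup>2 * exp (- (x / 4)) \<le> (32::real)" if "0 \<le> x"
proof -
  have "1 + x / 4 + (x / 4)\<^sup>2 / 2 \<le> exp (x / 4)" using that by (intro exp_lower_Taylor_quadratic) simp
  then have "x\<^sup>2 / 32 \<le> exp (x / 4)" using that by (simp add: power_divide)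
  then show ?thesis by (simp add: exp_minus field_simps)
qed

text \<open>
  Apply \<open>plancherel_le\<close> to \<open>exp (- (c + 1) t) f t\<close>, whose Fourier transform is the restriction of the
  Laplace transform to the line \<open>Re z = c + 1\<close>. For \<open>L < 1\<close> the trivial bound by \<open>m\<close> suffices near the
  origin; for \<open>L \<ge> 1\<close> the bound of \<open>two_constants\<close> with \<open>R = \<surd>L\<close> and \<open>S = 2 R\<close> is used there.
\<close>

proposition stability_smooth:
  fixes f :: "real \<Rightarrow> complex"
  assumes c: "0 \<le> c" and a: "0 \<le> a" "a \<le> b"
    and deriv: "\<And>t. (f has_vector_derivative f' t) (at t)" and cont: "continuous_on UNIV f'"
    and supp: "\<forall>t. t \<notin> {a<..<b} \<longrightarrow> f t = 0" "\<forall>t. t \<notin> {a<..<b} \<longrightarrow> f' t = 0"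
    and m: "(LINT t|lborel. exp (- c * t) * norm (f t))
      + (LINT t|lborel. exp (- c * t) * norm (f' t)) \<le> m"
    and e: "0 < e" "e < m"
    and axis: "\<And>s. c \<le> s \<Longrightarrow> norm (laplace f (of_real s)) \<le> e"
  shows "(LINT t|lborel. (exp (- (c + 1) * t) * norm (f t))\<^sup>2) \<le> 36 * m\<^sup>2 / sqrt (ln (m / e))"
proof -
  have contf: "continuous_on UNIV f"
    using deriv by (meson continuous_at_imp_continuous_on has_vector_derivative_continuous)
  have supp': "\<forall>t. t \<notin> {a..b} \<longrightarrow> f t = 0" "\<forall>t. t \<notin> {a..b} \<longrightarrow> f' t = 0" using supp by auto
  define L where "L = ln (m / e)"
  have L: "0 < L" using e by (simp add: L_def)
  have m0: "0 < m" using e by simp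
  have int0: "0 \<le> (LINT t|lborel. exp (- c * t) * norm (h t))" for h :: "real \<Rightarrow> complex"
    by (intro Bochner_Integration.integral_nonneg) auto
  have bound: "norm (laplace f z) \<le> m" if "c \<le> Re z" for z
    using norm_laplace_le[OF contf supp'(1) a(1) that] m int0[of f'] by linarith
  have bound': "norm (z * laplace f z) \<le> m" if "c \<le> Re z" for z
    unfolding laplace_deriv[OF deriv cont a(2) supp, symmetric]
    using norm_laplace_le[OF cont supp'(2) a(1) that] m int0[of f] by linarith
  define W where "W y = (norm (laplace f (Complex (c + 1) y)))\<^sup>2" for y
  have Wm: "W y \<le> m\<^sup>2" for y
    unfolding W_def by (intro power_mono bound) auto
  have far: "y\<^sup>2 * W y \<le> m\<^sup>2" for y
  proof -
    have "\<bar>y\<bar> * norm (laplace f (Complex (c + 1) y)) \<le> norm (Complex (c + 1) y * laplace f (Complex (c + 1) y))"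
      unfolding norm_mult using abs_Im_le_cmod[of "Complex (c + 1) y"] by (intro mult_right_mono) auto
    also have "\<dots> \<le> m" by (rule bound') simp
    finally have "(\<bar>y\<bar> * norm (laplace f (Complex (c + 1) y)))\<^sup>2 \<le> m\<^sup>2"
      by (intro power_mono) auto
    then show ?thesis by (simp add: W_def power_mult_distrib)
  qed
  define g where "g t = complex_of_real (exp (- (c + 1) * t)) * f t" for t
  have Fg: "(norm (fourier g y))\<^sup>2 = W y" for y
    unfolding g_def[abs_def] fourier_exp_weight W_def ..
  have gcont: "continuous_on UNIV g" unfolding g_def[abs_def] by (intro continuous_intros contf)
  have gsupp: "\<forall>t. t \<notin> {a..b} \<longrightarrow> g t = 0" using supp' by (auto simp: g_def)
  have [measurable]: "g \<in> borel_measurable borel"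
    using gcont by (rule borel_measurable_continuous_onI)
  have Wmeas: "W \<in> borel_measurable borel"
    unfolding Fg[symmetric, abs_def] by measurable
  have W0: "0 \<le> W y" for y by (simp add: W_def)
  have "(LINT t|lborel. (exp (- (c + 1) * t) * norm (f t))\<^sup>2) = (LINT t|lborel. (norm (g t))\<^sup>2)"
    by (simp add: g_def norm_mult)
  also have "\<dots> \<le> (LINT y|lborel. W y) / (2 * pi)"
    using plancherel_le[OF gcont gsupp] integral_split_bound(1)[OF Wmeas W0 zero_less_one Wm far]
    unfolding Fg by blast
  also have "\<dots> \<le> 36 * m\<^sup>2 / sqrt L"
  proof (cases "L < 1")
    case True
    have "(LINT y|lborel. W y) \<le> 4 * m\<^sup>2"
      using integral_split_bound(2)[OF Wmeas W0 zero_less_one Wm far] by simp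
    then have "(LINT y|lborel. W y) / (2 * pi) \<le> 4 * m\<^sup>2 / 2"
      using pi_gt3 by (intro frac_le) auto
    also have "\<dots> \<le> 36 * m\<^sup>2 / 1" by simp
    also have "\<dots> \<le> 36 * m\<^sup>2 / sqrt L" using L True by (intro frac_le) auto
    finally show ?thesis .
  next
    case False
    define R where "R = sqrt L"
    have R: "1 \<le> R" using False by (simp add: R_def)
    have LR: "L = R * R" using L by (simp add: R_def)
    have near: "W y \<le> m\<^sup>2 * exp (- (R / 4))" if "\<bar>y\<bar> \<le> R" for y
    proof -
      have "norm (laplace f (Complex (c + 1) y)) \<le> m * exp (- (L / (4 * (2 * R))))"
        unfolding L_def
        by (rule two_constants[OF laplace_holomorphic[OF contf supp'(1)] bound axis])
           (use e R that in auto)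
      then have "W y \<le> (m * exp (- (L / (4 * (2 * R)))))\<^sup>2"
        unfolding W_def by (intro power_mono) auto
      also have "\<dots> = m\<^sup>2 * exp (- (R / 4))"
        using R by (simp add: LR power_mult_distrib exp_double[symmetric])
      finally show ?thesis .
    qed
    have "R * (LINT y|lborel. W y) \<le> R * (2 * R * (m\<^sup>2 * exp (- (R / 4))) + 2 * m\<^sup>2 / R)"
      using R by (intro mult_left_mono integral_split_bound(2)[OF Wmeas W0 _ near far]) auto
    also have "\<dots> = 2 * m\<^sup>2 * (R\<^sup>2 * exp (- (R / 4))) + 2 * m\<^sup>2"
      using R by (simp add: field_simps power2_eq_square)
    also have "\<dots> \<le> 2 * m\<^sup>2 * 32 + 2 * m\<^sup>2"
      using R by (intro add_right_mono mult_left_mono square_mult_exp_minus_le) auto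
    finally have "R * (LINT y|lborel. W y) \<le> 66 * m\<^sup>2" by simp
    then have "(LINT y|lborel. W y) \<le> 66 * m\<^sup>2 / R" using R by (simp add: field_simps)
    then have "(LINT y|lborel. W y) / (2 * pi) \<le> 66 * m\<^sup>2 / R / 2"
      using pi_gt3 R by (intro frac_le) auto
    also have "\<dots> \<le> 36 * m\<^sup>2 / R" using R by (simp add: field_simps)
    finally show ?thesis by (simp add: R_def)
  qed
  finally show ?thesis by (simp add: L_def)
qed

section \<open>Smooth functions and bumps\<close>

abbreviation vderiv :: "(real \<Rightarrow> complex) \<Rightarrow> real \<Rightarrow> complex" where
  "vderiv g \<equiv> (\<lambda>s. vector_derivative g (at s))"

text \<open>
  The regularity requirement in \<open>test_functions\<close>.
\<close>

definition smooth :: "(real \<Rightarrow> complex) \<Rightarrow> bool" where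
  "smooth g \<longleftrightarrow> (\<forall>n t. (vderiv ^^ n) g differentiable (at t))"

text \<open>
  Smoothness is the largest class of differentiable functions that is closed under derivation. Thus
  to show that a function is smooth it suffices to place it in some class closed under
  derivation, which avoids computing any higher derivative.
\<close>

lemma smooth_coinduct:
  assumes "g \<in> X"
    and step: "\<And>g. g \<in> X \<Longrightarrow> \<exists>g'\<in>X. \<forall>t. (g has_vector_derivative g' t) (at t)"
  shows "smooth g"
proof -
  have closed: "vderiv g \<in> X" "g differentiable (at t)" if "g \<in> X" for g t
  proof -
    obtain g' where g': "g' \<in> X" "\<And>t. (g has_vector_derivative g' t) (at t)" using step[OF \<open>g \<in> X\<close>] by blast
    then have "vderiv g = g'" by (auto intro!: ext vector_derivative_at)
    then show "vderiv g \<in> X" "g differentiable (at t)"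
      using g' by (auto intro: differentiableI_vector)
  qed
  have "(vderiv ^^ n) g \<in> X" for n
    by (induction n) (use assms(1) closed in auto)
  then show ?thesis using closed by (auto simp: smooth_def)
qed

lemma smooth_has_vderiv: "smooth g \<Longrightarrow> (g has_vector_derivative vderiv g t) (at t)"
  unfolding smooth_def using vector_derivative_works by (metis funpow_0)

lemma smooth_vderiv: "smooth g \<Longrightarrow> smooth (vderiv g)"
  unfolding smooth_def by (metis funpow_Suc_right o_apply)

lemma smooth_continuous: "smooth g \<Longrightarrow> continuous_on A g"
  by (meson continuous_at_imp_continuous_on has_vector_derivative_continuous smooth_has_vderiv)

text \<open>
  Products alone are not closed under derivation, but by Leibniz' rule sums of products are.
\<close>

inductive_set smooth_products :: "(real \<Rightarrow> complex) set" where
  prod: "smooth f \<Longrightarrow> smooth g \<Longrightarrow> (\<lambda>t. f t * g t) \<in> smooth_products"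
| add: "f \<in> smooth_products \<Longrightarrow> g \<in> smooth_products \<Longrightarrow> (\<lambda>t. f t + g t) \<in> smooth_products"

lemma smooth_mult:
  assumes "smooth f" "smooth g"
  shows "smooth (\<lambda>t. f t * g t)"
proof (rule smooth_coinduct)
  show "(\<lambda>t. f t * g t) \<in> smooth_products" using assms by (rule smooth_products.prod)
  show "\<exists>h'\<in>smooth_products. \<forall>t. (h has_vector_derivative h' t) (at t)" if "h \<in> smooth_products" for h
    using that
  proof induction
    case (prod f g)
    have "(\<lambda>t. f t * vderiv g t + vderiv f t * g t) \<in> smooth_products"
      by (intro smooth_products.intros smooth_vderiv prod)
    then show ?case
      by (rule bexI[rotated]) (auto intro!: has_vector_derivative_mult smooth_has_vderiv prod)
  next
    case (add f g)
    then obtain f' g' where "f' \<in> smooth_products" "g' \<in> smooth_products"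
      "\<And>t. (f has_vector_derivative f' t) (at t)" "\<And>t. (g has_vector_derivative g' t) (at t)" by blast
    then show ?case
      by (intro bexI[of _ "\<lambda>t. f' t + g' t"]) (auto intro: has_vector_derivative_add smooth_products.add)
  qed
qed

lemma smooth_exp: "smooth (\<lambda>t. of_real (exp (k * t)))"
proof (rule smooth_coinduct)
  let ?X = "range (\<lambda>r t. complex_of_real (r * exp (k * t)))"
  show "(\<lambda>t. of_real (exp (k * t))) \<in> ?X" by (rule range_eqI[of _ _ 1]) simp
  show "\<exists>g'\<in>?X. \<forall>t. (g has_vector_derivative g' t) (at t)" if "g \<in> ?X" for g
  proof -
    from that obtain r where g: "g = (\<lambda>t. complex_of_real (r * exp (k * t)))" by blast
    have "((\<lambda>t. r * exp (k * t)) has_real_derivative (r * k) * exp (k * t)) (at t)" for t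
      by (auto intro!: derivative_eq_intros)
    then show ?thesis unfolding g
      by (intro bexI[of _ "\<lambda>t. complex_of_real ((r * k) * exp (k * t))"])
         (auto simp del: of_real_mult intro!: has_vector_derivative_of_real)
  qed
qed

text \<open>
  The terms that arise from the derivatives of the flat function \<open>exp (- \<mu> / x)\<close>, extended by \<open>0\<close>.
\<close>

definition flat_term :: "real \<Rightarrow> real \<Rightarrow> nat \<Rightarrow> real \<Rightarrow> real" where
  "flat_term \<mu> r n x = (if 0 < x then r * (1 / x) ^ n * exp (- \<mu> / x) else 0)"

text \<open>
  At \<open>x = 0\<close> the difference quotient tends to \<open>0\<close> because the exponential beats every power of \<open>1 / x\<close>.
  The formula for the derivative has the same shape as the function, so it covers all three cases of
  the sign of \<open>x\<close>.
\<close>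

lemma flat_term_has_derivative:
  assumes \<mu>: "0 < \<mu>"
  shows "(flat_term \<mu> r n has_real_derivative
     flat_term \<mu> (- (r * real n)) (Suc n) x + flat_term \<mu> (r * \<mu>) (n + 2) x) (at x)"
proof -
  consider "x < 0" | "0 < x" | "x = 0" by linarith
  then show ?thesis
  proof cases
    case 1
    have "(flat_term \<mu> r n has_real_derivative 0) (at x)"
      by (rule has_field_derivative_transform_within_open[where f="\<lambda>_. 0" and S="{..<0}"])
         (use 1 in \<open>auto simp: flat_term_def\<close>)
    then show ?thesis using 1 by (simp add: flat_term_def)
  next
    case 2
    have *: "((\<lambda>x. r * (1 / x) ^ n * exp (- \<mu> / x)) has_real_derivative
       r * (real n * (1 / x) ^ (n - 1) * (- 1 / x\<^sup>2)) * exp (- \<mu> / x)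
         + r * (1 / x) ^ n * (\<mu> / x\<^sup>2 * exp (- \<mu> / x))) (at x)"
      using 2 by (auto intro!: derivative_eq_intros simp: power2_eq_square algebra_simps)
    have "(flat_term \<mu> r n has_real_derivative
       r * (real n * (1 / x) ^ (n - 1) * (- 1 / x\<^sup>2)) * exp (- \<mu> / x)
         + r * (1 / x) ^ n * (\<mu> / x\<^sup>2 * exp (- \<mu> / x))) (at x)"
      by (rule has_field_derivative_transform_within_open[OF *, where S="{0<..}"])
         (use 2 in \<open>auto simp: flat_term_def\<close>)
    moreover have "r * (real n * (1 / x) ^ (n - 1) * (- 1 / x\<^sup>2)) * exp (- \<mu> / x)
         + r * (1 / x) ^ n * (\<mu> / x\<^sup>2 * exp (- \<mu> / x))
         = flat_term \<mu> (- (r * real n)) (Suc n) x + flat_term \<mu> (r * \<mu>) (n + 2) x"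
      using 2 by (cases n) (simp_all add: flat_term_def power2_eq_square power_one_over field_simps)
    ultimately show ?thesis by simp
  next
    case 3
    have "((\<lambda>h. flat_term \<mu> r n h / h) \<longlongrightarrow> 0) (at 0)"
    proof (rule filterlim_split_at)
      have "((\<lambda>h::real. 0) \<longlongrightarrow> 0) (at_left 0)" by simp
      then show "((\<lambda>h. flat_term \<mu> r n h / h) \<longlongrightarrow> 0) (at_left 0)"
        by (rule Lim_transform_eventually)
           (auto simp: flat_term_def eventually_at_left_field intro!: exI[of _ "-1"])
      have "((\<lambda>y::real. y ^ (n + 1) / exp y) \<longlongrightarrow> 0) at_top" by (rule tendsto_power_div_exp_0)
      moreover have "filterlim (\<lambda>h. \<mu> / h) at_top (at_right 0)"
        using \<mu> by (auto simp: divide_inverse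
          intro!: filterlim_tendsto_pos_mult_at_top[OF tendsto_const] filterlim_inverse_at_top_right)
      ultimately have "((\<lambda>h. (\<mu> / h) ^ (n + 1) / exp (\<mu> / h)) \<longlongrightarrow> 0) (at_right 0)"
        by (rule filterlim_compose)
      then have "((\<lambda>h. r / \<mu> ^ (n + 1) * ((\<mu> / h) ^ (n + 1) / exp (\<mu> / h))) \<longlongrightarrow> r / \<mu> ^ (n + 1) * 0) (at_right 0)"
        by (intro tendsto_mult tendsto_const)
      moreover have "eventually (\<lambda>h. r / \<mu> ^ (n + 1) * ((\<mu> / h) ^ (n + 1) / exp (\<mu> / h)) = flat_term \<mu> r n h / h) (at_right 0)"
        using \<mu> by (auto simp: eventually_at_right_field flat_term_def power_divide exp_minus field_simps
          intro!: exI[of _ 1])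
      ultimately show "((\<lambda>h. flat_term \<mu> r n h / h) \<longlongrightarrow> 0) (at_right 0)"
        by (auto intro: Lim_transform_eventually)
    qed
    then have "(flat_term \<mu> r n has_real_derivative 0) (at 0)"
      by (simp add: has_field_derivative_iff flat_term_def[of _ _ _ 0])
    then show ?thesis using 3 by (simp add: flat_term_def)
  qed
qed

text \<open>
  The substitution \<open>x = \<sigma> (t - a)\<close> covers both a left cut-off (\<open>\<sigma> = 1\<close>) and a right one (\<open>\<sigma> = -1\<close>).
\<close>

inductive_set flat_functions :: "real \<Rightarrow> real \<Rightarrow> real \<Rightarrow> (real \<Rightarrow> complex) set"
  for \<mu> \<sigma> a where
  monomial: "(\<lambda>t. of_real (flat_term \<mu> r n (\<sigma> * (t - a)))) \<in> flat_functions \<mu> \<sigma> a"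
| add: "f \<in> flat_functions \<mu> \<sigma> a \<Longrightarrow> g \<in> flat_functions \<mu> \<sigma> a \<Longrightarrow> (\<lambda>t. f t + g t) \<in> flat_functions \<mu> \<sigma> a"

lemma smooth_flat_term:
  assumes \<mu>: "0 < \<mu>"
  shows "smooth (\<lambda>t. of_real (flat_term \<mu> r n (\<sigma> * (t - a))))"
proof (rule smooth_coinduct)
  show "(\<lambda>t. of_real (flat_term \<mu> r n (\<sigma> * (t - a)))) \<in> flat_functions \<mu> \<sigma> a"
    by (rule flat_functions.monomial)
  show "\<exists>h'\<in>flat_functions \<mu> \<sigma> a. \<forall>t. (h has_vector_derivative h' t) (at t)"
    if "h \<in> flat_functions \<mu> \<sigma> a" for h
    using that
  proof induction
    case (monomial r n)
    let ?h' = "\<lambda>t. of_real (flat_term \<mu> (\<sigma> * - (r * real n)) (Suc n) (\<sigma> * (t - a)))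
       + complex_of_real (flat_term \<mu> (\<sigma> * (r * \<mu>)) (n + 2) (\<sigma> * (t - a)))"
    have "?h' \<in> flat_functions \<mu> \<sigma> a" by (intro flat_functions.intros)
    moreover have "((\<lambda>t. complex_of_real (flat_term \<mu> r n (\<sigma> * (t - a)))) has_vector_derivative ?h' t) (at t)" for t
    proof -
      have "((\<lambda>t. \<sigma> * (t - a)) has_real_derivative \<sigma>) (at t)"
        by (auto intro!: derivative_eq_intros)
      from DERIV_chain2[OF flat_term_has_derivative[OF \<mu>] this, of r n]
      have "((\<lambda>t. complex_of_real (flat_term \<mu> r n (\<sigma> * (t - a)))) has_vector_derivative
         complex_of_real ((flat_term \<mu> (- (r * real n)) (Suc n) (\<sigma> * (t - a)) + flat_term \<mu> (r * \<mu>) (n + 2) (\<sigma> * (t - a))) * \<sigma>)) (at t)"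
        by (rule has_vector_derivative_of_real)
      then show ?thesis
        by (rule back_subst[where P="\<lambda>d. (_ has_vector_derivative d) (at t)"])
           (auto simp: flat_term_def algebra_simps)
    qed
    ultimately show ?case by (intro bexI[of _ ?h'] allI)
  next
    case (add f g)
    then obtain f' g' where "f' \<in> flat_functions \<mu> \<sigma> a" "g' \<in> flat_functions \<mu> \<sigma> a"
      "\<And>t. (f has_vector_derivative f' t) (at t)" "\<And>t. (g has_vector_derivative g' t) (at t)" by blast
    then show ?case
      by (intro bexI[of _ "\<lambda>t. f' t + g' t"]) (auto intro: has_vector_derivative_add flat_functions.add)
  qed
qed

lemma test_functions_iff:
  "\<phi> \<in> test_functions \<longleftrightarrow> smooth \<phi> \<and> (\<exists>a b. 0 < a \<and> (\<forall>t. t \<notin> {a..b} \<longrightarrow> \<phi> t = 0))"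
  by (simp add: test_functions_def smooth_def)

lemma test_function_mult:
  assumes "smooth f" "\<phi> \<in> test_functions"
  shows "(\<lambda>t. f t * \<phi> t) \<in> test_functions"
  using assms smooth_mult[OF assms(1)] unfolding test_functions_iff by (metis mult_zero_right)

text \<open>
  On \<open>(a, b)\<close> this is \<open>exp (- \<mu> / (t - a)) exp (- \<mu> / (b - t))\<close> with \<open>\<mu> = 1 / (n + 1)\<close>; it is smooth
  for each \<open>n\<close> and increases to the indicator of \<open>(a, b)\<close> as \<open>\<mu>\<close> decreases to \<open>0\<close>.
\<close>

definition bump :: "nat \<Rightarrow> real \<Rightarrow> real \<Rightarrow> real \<Rightarrow> real" where
  "bump n a b t = flat_term (1 / real (Suc n)) 1 0 (t - a) * flat_term (1 / real (Suc n)) 1 0 (b - t)"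

lemma bump_test_function:
  assumes "0 < a"
  shows "(\<lambda>t. of_real (bump n a b t)) \<in> test_functions"
  unfolding test_functions_iff
proof
  show "smooth (\<lambda>t. of_real (bump n a b t))"
    unfolding bump_def of_real_mult
    by (rule smooth_mult)
       (use smooth_flat_term[of "1 / real (Suc n)" 1 0 1 a] smooth_flat_term[of "1 / real (Suc n)" 1 0 "-1" b] in simp_all)
  show "\<exists>a' b'. 0 < a' \<and> (\<forall>t. t \<notin> {a'..b'} \<longrightarrow> complex_of_real (bump n a b t) = 0)"
    using assms by (intro exI[of _ a] exI[of _ b]) (auto simp: bump_def flat_term_def)
qed

lemma bump_bound: "\<bar>bump n a b t\<bar> \<le> indicator {a..b} t"
proof -
  have "flat_term (1 / real (Suc n)) 1 0 x \<le> 1" "0 \<le> flat_term (1 / real (Suc n)) 1 0 x" for x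
    by (auto simp: flat_term_def)
  then show ?thesis
    by (cases "t \<in> {a..b}") (auto simp: bump_def abs_mult mult_le_one, auto simp: flat_term_def)
qed

lemma bump_tendsto: "(\<lambda>n. bump n a b t) \<longlonglongrightarrow> indicator {a<..<b} t"
proof -
  have lim: "(\<lambda>n. flat_term (1 / real (Suc n)) 1 0 x) \<longlonglongrightarrow> (if 0 < x then 1 else 0)" for x
  proof (cases "0 < x")
    case True
    have "(\<lambda>n. exp (- (1 / real (Suc n)) / x)) \<longlonglongrightarrow> exp (- 0 / x)"
      by (intro tendsto_intros LIMSEQ_inverse_real_of_nat[unfolded inverse_eq_divide]) (use True in auto)
    then show ?thesis using True by (simp add: flat_term_def)
  qed (simp add: flat_term_def)
  have "(\<lambda>n. bump n a b t) \<longlonglongrightarrow> (if 0 < t - a then 1 else 0) * (if 0 < b - t then 1 else 0)"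
    unfolding bump_def by (intro tendsto_mult lim)
  also have "(if 0 < t - a then 1 else 0) * (if 0 < b - t then 1 else 0) = (indicator {a<..<b} t :: real)"
    by (auto simp: indicator_def)
  finally show ?thesis .
qed

section \<open>Local integrability and the fundamental lemma of the calculus of variations\<close>

abbreviation halfline :: "real measure" where
  "halfline \<equiv> lebesgue_on {0<..}"

lemma halfline_integrable_iff:
  fixes f :: "real \<Rightarrow> 'a::{banach, second_countable_topology}"
  shows "integrable halfline f \<longleftrightarrow> integrable lebesgue (\<lambda>x. indicator {0<..} x *\<^sub>R f x)"
  by (rule integrable_restrict_space) simp

lemma halfline_integral_eq:
  fixes f :: "real \<Rightarrow> 'a::{banach, second_countable_topology}"
  shows "(LINT t|halfline. f t) = (LINT t|lebesgue. indicator {0<..} t *\<^sub>R f t)"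
  by (rule integral_restrict_space) simp

lemma AE_halfline_iff: "(AE t in halfline. P t) \<longleftrightarrow> (AE t in lebesgue. 0 < t \<longrightarrow> P t)"
  by (subst AE_restrict_space_iff) auto

text \<open>
  The densities \<open>g\<^sup>+\<close> and \<open>g\<^sup>-\<close> define finite measures that agree on the half-lines
  \<open>(x,\<infinity>)\<close>, which generate the Borel sets; hence they are equal.
\<close>

lemma AE_eq_0_if_tail_integrals_0_real:
  fixes g :: "real \<Rightarrow> real"
  assumes g: "integrable lborel g" and zero: "\<And>x. (LINT t|lborel. g t * indicator {x<..} t) = 0"
  shows "AE t in lborel. g t = 0"
proof -
  have [measurable]: "g \<in> borel_measurable borel" using g by auto
  let ?M = "density lborel (\<lambda>t. ennreal (g t))" and ?N = "density lborel (\<lambda>t. ennreal (- g t))"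
  have eM: "emeasure (density lborel (\<lambda>t. ennreal (h t))) {x<..} = ennreal (LINT t|lborel. max 0 (h t) * indicator {x<..} t)"
    if h: "integrable lborel h" for h :: "real \<Rightarrow> real" and x
  proof -
    have [measurable]: "h \<in> borel_measurable borel" using h by auto
    have "integrable lborel (\<lambda>t. max 0 (h t) * indicator {x<..} t)"
      using h by (intro integrable_real_mult_indicator) auto
    then have "(\<integral>\<^sup>+t. ennreal (max 0 (h t) * indicator {x<..} t) \<partial>lborel) = ennreal (LINT t|lborel. max 0 (h t) * indicator {x<..} t)"
      by (intro nn_integral_eq_integral) auto
    moreover have "ennreal (max 0 r * indicator {x<..} t) = ennreal r * indicator {x<..} t" for r t
      by (auto simp: indicator_def max_def ennreal_neg)
    ultimately show ?thesis by (simp add: emeasure_density)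
  qed
  have ng: "integrable lborel (\<lambda>t. - g t)" using g by simp
  have "?M = ?N"
  proof (rule measure_eqI_lessThan)
    show "emeasure ?M {x<..} < \<infinity>" for x by (simp add: eM[OF g])
    show "emeasure ?M {x<..} = emeasure ?N {x<..}" for x
    proof -
      have "integrable lborel (\<lambda>t. max 0 (g t) * indicator {x<..} t)" "integrable lborel (\<lambda>t. max 0 (- g t) * indicator {x<..} t)"
        using g ng by (auto intro!: integrable_real_mult_indicator)
      then have "(LINT t|lborel. max 0 (g t) * indicator {x<..} t) - (LINT t|lborel. max 0 (- g t) * indicator {x<..} t)
          = (LINT t|lborel. max 0 (g t) * indicator {x<..} t - max 0 (- g t) * indicator {x<..} t)"
        by simp
      also have "\<dots> = (LINT t|lborel. g t * indicator {x<..} t)"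
        by (rule Bochner_Integration.integral_cong) (auto simp: indicator_def)
      finally show ?thesis by (simp add: eM[OF g] eM[OF ng] zero)
    qed
  qed auto
  then have "AE t in lborel. ennreal (g t) = ennreal (- g t)"
    by (intro sigma_finite_measure.density_unique[OF sigma_finite_lborel]) auto
  then show ?thesis
  proof eventually_elim
    case (elim t)
    then show ?case by (cases "0 \<le> g t") (auto simp: ennreal_neg ennreal_eq_0_iff)
  qed
qed

text \<open>
  Real and imaginary parts of a Lebesgue measurable function are treated separately, each replaced by
  a Borel measurable representative.
\<close>

lemma AE_eq_0_if_tail_integrals_0:
  fixes h :: "real \<Rightarrow> complex"
  assumes h: "integrable lebesgue h" and zero: "\<And>x. (LINT t|lebesgue. indicator {x<..} t *\<^sub>R h t) = 0"
  shows "AE t in lebesgue. h t = 0"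
proof -
  have real: "AE t in lebesgue. u t = 0"
    if u: "integrable lebesgue u" and z: "\<And>x. (LINT t|lebesgue. u t * indicator {x<..} t) = 0" for u :: "real \<Rightarrow> real"
  proof -
    have um[measurable]: "u \<in> borel_measurable lebesgue" using u by auto
    obtain v where v[measurable]: "v \<in> borel_measurable lborel" and ae: "AE t in lborel. u t = v t"
      using completion_ex_borel_measurable_real[OF um] by auto
    have vm[measurable]: "v \<in> borel_measurable lebesgue" using v by (rule measurable_completion)
    have ae': "AE t in lebesgue. u t = v t" using ae by (rule AE_completion)
    have "integrable lebesgue v" using u ae' by (subst integrable_cong_AE[OF vm um]) auto
    then have "integrable lborel v" using v by (simp add: integrable_completion)
    moreover have "(LINT t|lborel. v t * indicator {x<..} t) = 0" for x
    proof -
      have "(LINT t|lborel. v t * indicator {x<..} t) = (LINT t|lebesgue. v t * indicator {x<..} t)"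
        by (rule integral_completion[symmetric]) measurable
      also have "\<dots> = (LINT t|lebesgue. u t * indicator {x<..} t)"
        using ae' by (intro integral_cong_AE borel_measurable_times um vm borel_measurable_indicator) auto
      finally show ?thesis using z by simp
    qed
    ultimately have "AE t in lborel. v t = 0" by (rule AE_eq_0_if_tail_integrals_0_real)
    then have "AE t in lborel. u t = 0" using ae by eventually_elim simp
    then show ?thesis by (rule AE_completion)
  qed
  have ih: "integrable lebesgue (\<lambda>t. indicator {x<..} t *\<^sub>R h t)" for x
    using h by (intro integrable_mult_indicator) auto
  have "(LINT t|lebesgue. Re (h t) * indicator {x<..} t) = 0" for x
    using integral_Re[OF ih, of x] zero[of x] by (simp add: mult.commute)
  moreover have "(LINT t|lebesgue. Im (h t) * indicator {x<..} t) = 0" for x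
    using integral_Im[OF ih, of x] zero[of x] by (simp add: mult.commute)
  ultimately have "AE t in lebesgue. Re (h t) = 0" "AE t in lebesgue. Im (h t) = 0"
    using h by (auto intro!: real)
  then show ?thesis by eventually_elim (simp add: complex_eq_iff)
qed

lemma borel_imp_lebesgue_measurable:
  fixes f :: "real \<Rightarrow> 'a::topological_space"
  shows "f \<in> borel_measurable borel \<Longrightarrow> f \<in> borel_measurable lebesgue"
  by (intro measurable_completion) simp

lemma continuous_lebesgue_measurable:
  fixes f :: "real \<Rightarrow> 'a::topological_space"
  shows "continuous_on UNIV f \<Longrightarrow> f \<in> borel_measurable lebesgue"
  by (intro borel_imp_lebesgue_measurable borel_measurable_continuous_onI)

text \<open>
  A locally integrable function is controlled only on compact subintervals of \<open>(0,\<infinity>)\<close>; these intervals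
  exhaust the half-line.
\<close>

lemma eventually_in_exhausting_interval:
  fixes t :: real
  assumes t: "0 < t"
  shows "\<exists>N. \<forall>n\<ge>N. t \<in> {1 / real (Suc n)<..<real n}"
proof -
  obtain N1 where N1: "t < real N1" using reals_Archimedean2 by blast
  obtain N2 where N2: "1 / t < real N2" using reals_Archimedean2 by blast
  have "t \<in> {1 / real (Suc n)<..<real n}" if "max N1 N2 \<le> n" for n
  proof -
    have "1 / t < real (Suc n)" using N2 that by linarith
    then have "1 < real (Suc n) * t" using t by (simp only: pos_divide_less_eq)
    then have "1 / real (Suc n) < t" by (simp add: pos_divide_less_eq mult.commute)
    moreover have "t < real n" using N1 that by linarith
    ultimately show ?thesis by simp
  qed
  then show ?thesis by blast
qed

lemma locally_integrable_mult:
  fixes h \<psi> :: "real \<Rightarrow> complex"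
  assumes h: "locally_integrable h" and cont: "continuous_on UNIV \<psi>"
    and a: "0 < a" and supp: "\<forall>t. t \<notin> {a..b} \<longrightarrow> \<psi> t = 0"
  shows "integrable halfline (\<lambda>t. h t * \<psi> t)"
proof -
  have i: "integrable lebesgue (\<lambda>t. indicator {a..b} t *\<^sub>R h t)"
    using h a by (auto simp: locally_integrable_def set_integrable_def)
  have "bounded (\<psi> ` {a..b})"
    by (intro compact_imp_bounded compact_continuous_image continuous_on_subset[OF cont]) auto
  then obtain K where "\<forall>x\<in>\<psi> ` {a..b}. norm x \<le> K" unfolding bounded_iff by blast
  then have K: "norm (\<psi> t) \<le> K" if "t \<in> {a..b}" for t using that by blast
  have [measurable]: "\<psi> \<in> borel_measurable lebesgue" using cont by (rule continuous_lebesgue_measurable)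
  have [measurable]: "(\<lambda>t. indicator {a..b} t *\<^sub>R h t) \<in> borel_measurable lebesgue" using i by auto
  have "integrable lebesgue (\<lambda>t. (indicator {a..b} t *\<^sub>R h t) * \<psi> t)"
  proof (rule Bochner_Integration.integrable_bound)
    show "integrable lebesgue (\<lambda>t. (indicator {a..b} t *\<^sub>R h t) * of_real K)"
      by (intro integrable_mult_left i)
    show "AE t in lebesgue. norm ((indicator {a..b} t *\<^sub>R h t) * \<psi> t) \<le> norm ((indicator {a..b} t *\<^sub>R h t) * complex_of_real K)"
      using K by (intro AE_I2) (auto simp: indicator_def norm_mult intro!: mult_left_mono order.trans[OF K])
  qed measurable
  also have "(\<lambda>t. (indicator {a..b} t *\<^sub>R h t) * \<psi> t) = (\<lambda>t. indicator {0<..} t *\<^sub>R (h t * \<psi> t))"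
    using a supp by (auto simp: indicator_def fun_eq_iff)
  finally show ?thesis by (simp add: halfline_integrable_iff)
qed

lemma locally_integrable_measurable:
  assumes h: "locally_integrable h"
  shows "h \<in> borel_measurable halfline"
proof -
  have "(\<lambda>t. indicator {0<..} t *\<^sub>R h t) \<in> borel_measurable lebesgue"
  proof (rule borel_measurable_LIMSEQ_metric)
    show "(\<lambda>t. indicator {1 / real (Suc n)..real n} t *\<^sub>R h t) \<in> borel_measurable lebesgue" for n
      using h[unfolded locally_integrable_def set_integrable_def, rule_format, of "1 / real (Suc n)" "real n"]
      by (intro borel_measurable_integrable) simp
    show "(\<lambda>n. indicator {1 / real (Suc n)..real n} t *\<^sub>R h t) \<longlonglongrightarrow> indicator {0<..} t *\<^sub>R h t" for t
    proof (cases "0 < t")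
      case True
      obtain N where N: "t \<in> {1 / real (Suc n)<..<real n}" if "N \<le> n" for n
        using eventually_in_exhausting_interval[OF True] by blast
      then have "eventually (\<lambda>n. indicator {0<..} t *\<^sub>R h t = indicator {1 / real (Suc n)..real n} t *\<^sub>R h t) sequentially"
        using True N by (intro eventually_sequentiallyI[of N]) (force simp: indicator_def)
      then show ?thesis by (rule Lim_transform_eventually[OF tendsto_const])
    next
      case False
      moreover have "0 < 1 / real (Suc n)" for n by simp
      ultimately have "t \<notin> {1 / real (Suc n)..real n}" for n
        by (metis atLeastAtMost_iff order.strict_trans2)
      then show ?thesis using False by simp
    qed
  qed
  then show ?thesis by (subst borel_measurable_restrict_space_iff) auto
qed

lemma locally_integrable_continuous:
  "continuous_on UNIV f \<Longrightarrow> locally_integrable f"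
  unfolding locally_integrable_def
  by (intro allI impI absolutely_integrable_continuous_real) (metis continuous_on_subset subset_UNIV)

lemma locally_integrable_add:
  "locally_integrable f \<Longrightarrow> locally_integrable g \<Longrightarrow> locally_integrable (\<lambda>t. f t + g t)"
  unfolding locally_integrable_def by (metis set_integral_add(1))

lemma locally_integrable_diff:
  "locally_integrable f \<Longrightarrow> locally_integrable g \<Longrightarrow> locally_integrable (\<lambda>t. f t - g t)"
  unfolding locally_integrable_def by (metis set_integral_diff(1))

lemma locally_integrable_continuous_mult:
  fixes u :: "real \<Rightarrow> complex"
  assumes u: "continuous_on UNIV u" and f: "locally_integrable f"
  shows "locally_integrable (\<lambda>t. u t * f t)"
  unfolding locally_integrable_def
proof (intro allI impI)
  fix a b :: real assume "0 < a"
  then have "f absolutely_integrable_on {a..b}" using f by (simp add: locally_integrable_def)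
  moreover have "bounded (u ` {a..b})"
    by (intro compact_imp_bounded compact_continuous_image continuous_on_subset[OF u]) auto
  moreover have "u \<in> borel_measurable (lebesgue_on {a..b})"
    using continuous_lebesgue_measurable[OF u] by (rule measurable_restrict_space1)
  ultimately show "(\<lambda>t. u t * f t) absolutely_integrable_on {a..b}"
    by (intro absolutely_integrable_bounded_measurable_product[of "(*)" u, OF bilinear_times]) simp_all
qed

text \<open>
  Testing against the bumps of an interval and passing to the limit by dominated convergence shows
  that \<open>h\<close> integrates to \<open>0\<close> over each interval \<open>(a, b)\<close> with \<open>a > 0\<close>, and intervals determine an
  integrable function up to null sets.
\<close>

lemma fundamental_lemma:
  assumes h: "locally_integrable h"
    and zero: "\<And>\<phi>. \<phi> \<in> test_functions \<Longrightarrow> (LINT t|halfline. h t * \<phi> t) = 0"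
  shows "AE t in halfline. h t = 0"
proof -
  have interval: "(LINT t|lebesgue. indicator {a<..<b} t *\<^sub>R h t) = 0" if a: "0 < a" for a b
  proof -
    have i: "integrable lebesgue (\<lambda>t. indicator {a..b} t *\<^sub>R h t)"
      using h a by (auto simp: locally_integrable_def set_integrable_def)
    have [measurable]: "(\<lambda>t. indicator {a..b} t *\<^sub>R h t) \<in> borel_measurable lebesgue" using i by auto
    let ?u = "\<lambda>n t. (indicator {a..b} t *\<^sub>R h t) * complex_of_real (bump n a b t)"
    have "(\<lambda>n. LINT t|lebesgue. ?u n t) \<longlonglongrightarrow>
       (LINT t|lebesgue. (indicator {a..b} t *\<^sub>R h t) * complex_of_real (indicator {a<..<b} t))"
    proof (rule integral_dominated_convergence[where w="\<lambda>t. norm (indicator {a..b} t *\<^sub>R h t)"])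
      show "integrable lebesgue (\<lambda>t. norm (indicator {a..b} t *\<^sub>R h t))" using i by (rule integrable_norm)
      show "?u n \<in> borel_measurable lebesgue" for n
      proof -
        have "smooth (\<lambda>t. complex_of_real (bump n a b t))"
          using bump_test_function[OF a] by (simp add: test_functions_iff)
        then have [measurable]: "(\<lambda>t. complex_of_real (bump n a b t)) \<in> borel_measurable lebesgue"
          by (intro continuous_lebesgue_measurable smooth_continuous)
        show ?thesis by measurable
      qed
      show "AE t in lebesgue. norm (?u n t) \<le> norm (indicator {a..b} t *\<^sub>R h t)" for n
      proof (rule AE_I2)
        fix t
        have "\<bar>bump n a b t\<bar> \<le> 1" by (rule order.trans[OF bump_bound indicator_le_1])
        then show "norm (?u n t) \<le> norm (indicator {a..b} t *\<^sub>R h t)"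
          unfolding norm_mult norm_of_real by (intro mult_left_le) auto
      qed
      show "AE t in lebesgue. (\<lambda>n. ?u n t) \<longlonglongrightarrow> (indicator {a..b} t *\<^sub>R h t) * complex_of_real (indicator {a<..<b} t)"
        by (intro AE_I2 tendsto_mult tendsto_const tendsto_of_real bump_tendsto)
      show "(\<lambda>t. (indicator {a..b} t *\<^sub>R h t) * complex_of_real (indicator {a<..<b} t)) \<in> borel_measurable lebesgue"
        by (intro borel_measurable_times borel_imp_lebesgue_measurable[of "\<lambda>t. complex_of_real (indicator {a<..<b} t)"])
           measurable
    qed
    moreover have "(LINT t|lebesgue. ?u n t) = 0" for n
    proof -
      have "?u n t = indicator {0<..} t *\<^sub>R (h t * complex_of_real (bump n a b t))" for t
        using bump_bound[of n a b t] a by (cases "t \<in> {a..b}") auto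
      then have "(LINT t|lebesgue. ?u n t) = (LINT t|halfline. h t * complex_of_real (bump n a b t))"
        by (simp only: halfline_integral_eq)
      also have "\<dots> = 0" using bump_test_function[OF a] by (rule zero)
      finally show ?thesis .
    qed
    ultimately have "(LINT t|lebesgue. (indicator {a..b} t *\<^sub>R h t) * complex_of_real (indicator {a<..<b} t)) = 0"
      by (simp add: LIMSEQ_const_iff)
    also have "(\<lambda>t. (indicator {a..b} t *\<^sub>R h t) * complex_of_real (indicator {a<..<b} t)) = (\<lambda>t. indicator {a<..<b} t *\<^sub>R h t)"
      by (auto simp: indicator_def fun_eq_iff)
    finally show ?thesis .
  qed
  have piece: "AE t in lebesgue. indicator {1 / real (Suc n)<..<real n} t *\<^sub>R h t = 0" for n
  proof (rule AE_eq_0_if_tail_integrals_0)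
    have "integrable lebesgue (\<lambda>t. indicator {1 / real (Suc n)..real n} t *\<^sub>R h t)"
      using h by (auto simp: locally_integrable_def set_integrable_def)
    then have "integrable lebesgue (\<lambda>t. indicator {1 / real (Suc n)<..<real n} t *\<^sub>R (indicator {1 / real (Suc n)..real n} t *\<^sub>R h t))"
      by (rule integrable_mult_indicator[rotated]) simp
    also have "(\<lambda>t. indicator {1 / real (Suc n)<..<real n} t *\<^sub>R (indicator {1 / real (Suc n)..real n} t *\<^sub>R h t))
       = (\<lambda>t. indicator {1 / real (Suc n)<..<real n} t *\<^sub>R h t)"
      by (auto simp: indicator_def fun_eq_iff)
    finally show "integrable lebesgue (\<lambda>t. indicator {1 / real (Suc n)<..<real n} t *\<^sub>R h t)" .
    fix x
    have "(\<lambda>t. indicator {x<..} t *\<^sub>R indicator {1 / real (Suc n)<..<real n} t *\<^sub>R h t)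
       = (\<lambda>t. indicator {max x (1 / real (Suc n))<..<real n} t *\<^sub>R h t)"
      by (auto simp: indicator_def fun_eq_iff)
    then show "(LINT t|lebesgue. indicator {x<..} t *\<^sub>R indicator {1 / real (Suc n)<..<real n} t *\<^sub>R h t) = 0"
      by (simp only:) (rule interval, simp add: less_max_iff_disj)
  qed
  then have "AE t in lebesgue. \<forall>n. indicator {1 / real (Suc n)<..<real n} t *\<^sub>R h t = 0"
    by (simp only: AE_all_countable) blast
  then show ?thesis
    unfolding AE_halfline_iff
  proof eventually_elim
    case (elim t)
    show ?case
    proof
      assume t: "0 < t"
      obtain N where "t \<in> {1 / real (Suc n)<..<real n}" if "N \<le> n" for n
        using eventually_in_exhausting_interval[OF t] by blast
      then have "t \<in> {1 / real (Suc N)<..<real N}" by simp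
      then show "h t = 0" using elim[rule_format, of N] by simp
    qed
  qed
qed

section \<open>Weak derivatives\<close>

lemma test_function_smooth: "\<phi> \<in> test_functions \<Longrightarrow> smooth \<phi>"
  by (simp add: test_functions_iff)

text \<open>
  The compact support is enlarged to an open interval, so that both functions vanish at its end points
  as well.
\<close>

lemma test_function_support:
  assumes "\<phi> \<in> test_functions"
  obtains a b where "0 < a" "a < b"
    "\<forall>t. t \<notin> {a<..<b} \<longrightarrow> \<phi> t = 0" "\<forall>t. t \<notin> {a<..<b} \<longrightarrow> vderiv \<phi> t = 0"
proof -
  obtain a b where a: "0 < a" and z: "\<forall>t. t \<notin> {a..b} \<longrightarrow> \<phi> t = 0"
    using assms by (auto simp: test_functions_iff)
  have "vderiv \<phi> t = 0" if t: "t \<notin> {a..b}" for t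
  proof -
    have "(\<phi> has_vector_derivative 0) (at t)"
    proof (rule has_vector_derivative_transform_within_open)
      show "((\<lambda>_. 0) has_vector_derivative (0::complex)) (at t)" by simp
      show "open (- {a..b})" by auto
    qed (use t z in auto)
    then show ?thesis by (rule vector_derivative_at)
  qed
  moreover have "t \<notin> {a..b}" if "t \<notin> {a / 2<..<a + \<bar>b\<bar> + 1}" for t
    using that a by auto
  ultimately show ?thesis using a z by (intro that[of "a / 2" "a + \<bar>b\<bar> + 1"]) auto
qed

lemma test_function_vderiv:
  assumes "\<phi> \<in> test_functions"
  shows "vderiv \<phi> \<in> test_functions"
proof -
  obtain a b where "0 < a" "\<forall>t. t \<notin> {a<..<b} \<longrightarrow> vderiv \<phi> t = 0"
    using test_function_support[OF assms] .
  then show ?thesis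
    using smooth_vderiv[OF test_function_smooth[OF assms]]
    unfolding test_functions_iff
    by (metis atLeastAtMost_iff greaterThanLessThan_iff less_eq_real_def)
qed

lemma locally_integrable_mult_test_function:
  assumes "locally_integrable h" "\<phi> \<in> test_functions"
  shows "integrable halfline (\<lambda>t. h t * \<phi> t)"
  using assms locally_integrable_mult smooth_continuous unfolding test_functions_iff by metis

lemma test_function_locally_integrable: "\<phi> \<in> test_functions \<Longrightarrow> locally_integrable \<phi>"
  by (intro locally_integrable_continuous smooth_continuous test_function_smooth)

lemma halfline_integral_continuous:
  fixes f :: "real \<Rightarrow> complex"
  assumes cont: "continuous_on UNIV f" and supp: "\<And>t. t \<le> 0 \<Longrightarrow> f t = 0"
  shows "(LINT t|halfline. f t) = (LINT t|lborel. f t)"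
proof -
  have "(\<lambda>t. indicator {0<..} t *\<^sub>R f t) = f"
    using supp by (auto simp: indicator_def fun_eq_iff not_less)
  then have "(LINT t|halfline. f t) = (LINT t|lebesgue. f t)" by (simp add: halfline_integral_eq)
  also have "\<dots> = (LINT t|lborel. f t)"
    using borel_measurable_continuous_onI[OF cont] by (intro integral_completion) simp
  finally show ?thesis .
qed

lemma test_function_weak_derivative:
  assumes \<phi>: "\<phi> \<in> test_functions"
  shows "has_weak_derivative \<phi> (vderiv \<phi>)"
  unfolding has_weak_derivative_def
proof (intro conjI ballI test_function_locally_integrable test_function_vderiv \<phi>)
  fix \<psi> assume \<psi>: "\<psi> \<in> test_functions"
  obtain a b where ab: "0 < a" "a < b" and z: "\<forall>t. t \<notin> {a<..<b} \<longrightarrow> \<phi> t = 0" "\<forall>t. t \<notin> {a<..<b} \<longrightarrow> vderiv \<phi> t = 0"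
    using test_function_support[OF \<phi>] .
  note sm = test_function_smooth[OF \<phi>] test_function_smooth[OF \<psi>]
  note cont = smooth_continuous[OF sm(1), of UNIV] smooth_continuous[OF smooth_vderiv[OF sm(1)], of UNIV]
    smooth_continuous[OF sm(2), of UNIV] smooth_continuous[OF smooth_vderiv[OF sm(2)], of UNIV]
  have "laplace (\<lambda>t. \<phi> t * vderiv \<psi> t + vderiv \<phi> t * \<psi> t) 0 = 0"
    by (subst laplace_deriv[where a=a and b=b and f="\<lambda>t. \<phi> t * \<psi> t"])
       (use ab z in \<open>auto intro!: has_vector_derivative_mult smooth_has_vderiv sm continuous_intros cont\<close>)
  then have "0 = (LINT t|lborel. \<phi> t * vderiv \<psi> t + vderiv \<phi> t * \<psi> t)"
    by (simp add: laplace_def)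
  also have "\<dots> = (LINT t|lborel. \<phi> t * vderiv \<psi> t) + (LINT t|lborel. vderiv \<phi> t * \<psi> t)"
    by (intro Bochner_Integration.integral_add continuous_compact_support_integrable(1)[where a=a and b=b])
       (use z in \<open>auto intro!: continuous_intros cont\<close>)
  also have "(LINT t|lborel. \<phi> t * vderiv \<psi> t) = (LINT t|halfline. \<phi> t * vderiv \<psi> t)"
    by (rule halfline_integral_continuous[symmetric])
       (use z ab in \<open>auto intro!: continuous_intros cont\<close>)
  also have "(LINT t|lborel. vderiv \<phi> t * \<psi> t) = (LINT t|halfline. vderiv \<phi> t * \<psi> t)"
    by (rule halfline_integral_continuous[symmetric])
       (use z ab in \<open>auto intro!: continuous_intros cont\<close>)
  finally show "(LINT t|halfline. \<phi> t * vderiv \<psi> t) = - (LINT t|halfline. vderiv \<phi> t * \<psi> t)"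
    by (simp add: eq_neg_iff_add_eq_0)
qed

lemma has_weak_derivative_weak_derivative:
  "has_weak_derivative f h \<Longrightarrow> has_weak_derivative f (weak_derivative f)"
  unfolding weak_derivative_def by (rule someI[of "has_weak_derivative f"])

lemma weak_derivative_unique:
  assumes h: "has_weak_derivative f h" and k: "has_weak_derivative f k"
  shows "AE t in halfline. h t = k t"
proof -
  have hk: "locally_integrable h" "locally_integrable k" using h k by (auto simp: has_weak_derivative_def)
  have "AE t in halfline. h t - k t = 0"
  proof (rule fundamental_lemma)
    show "locally_integrable (\<lambda>t. h t - k t)" using hk by (rule locally_integrable_diff)
    fix \<phi> assume \<phi>: "\<phi> \<in> test_functions"
    have "(LINT t|halfline. (h t - k t) * \<phi> t) = (LINT t|halfline. h t * \<phi> t) - (LINT t|halfline. k t * \<phi> t)"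
      using hk \<phi> by (simp add: left_diff_distrib locally_integrable_mult_test_function)
    also have "\<dots> = 0"
      using h k \<phi> unfolding has_weak_derivative_def by (metis diff_self neg_equal_iff_equal)
    finally show "(LINT t|halfline. (h t - k t) * \<phi> t) = 0" .
  qed
  then show ?thesis by eventually_elim simp
qed

lemma has_weak_derivative_diff:
  assumes f: "has_weak_derivative f f'" and g: "has_weak_derivative g g'"
  shows "has_weak_derivative (\<lambda>t. f t - g t) (\<lambda>t. f' t - g' t)"
  unfolding has_weak_derivative_def
proof (intro conjI ballI)
  have li: "locally_integrable f" "locally_integrable g" "locally_integrable f'" "locally_integrable g'"
    using f g by (auto simp: has_weak_derivative_def)
  show "locally_integrable (\<lambda>t. f t - g t)" "locally_integrable (\<lambda>t. f' t - g' t)"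
    using li by (auto intro: locally_integrable_diff)
  fix \<phi> assume \<phi>: "\<phi> \<in> test_functions"
  note i = locally_integrable_mult_test_function
  have "(LINT t|halfline. (f t - g t) * vderiv \<phi> t) = (LINT t|halfline. f t * vderiv \<phi> t) - (LINT t|halfline. g t * vderiv \<phi> t)"
    using i[OF li(1) test_function_vderiv[OF \<phi>]] i[OF li(2) test_function_vderiv[OF \<phi>]]
    by (simp add: left_diff_distrib)
  also have "\<dots> = - ((LINT t|halfline. f' t * \<phi> t) - (LINT t|halfline. g' t * \<phi> t))"
    using f g \<phi> by (simp add: has_weak_derivative_def)
  also have "\<dots> = - (LINT t|halfline. (f' t - g' t) * \<phi> t)"
    using i[OF li(3) \<phi>] i[OF li(4) \<phi>] by (simp add: left_diff_distrib)
  finally show "(LINT t|halfline. (f t - g t) * vderiv \<phi> t) = - (LINT t|halfline. (f' t - g' t) * \<phi> t)" .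
qed

text \<open>
  Membership in the weighted space speaks of the weak derivative \<open>h\<close> of \<open>exp (- c t) f t\<close>. The product
  rule recovers that of \<open>f\<close>: test the given identity against \<open>exp (c t) \<phi> t\<close>, again a test function.
\<close>

lemma has_weak_derivative_exp_weight:
  assumes h: "has_weak_derivative (exp_weight c f) h"
  shows "has_weak_derivative f (\<lambda>t. of_real (exp (c * t)) * h t + of_real c * f t)"
  unfolding has_weak_derivative_def
proof (intro conjI ballI)
  let ?E = "\<lambda>t. complex_of_real (exp (c * t))"
  have inv: "?E t * exp_weight c f t = f t" for t
    by (simp add: exp_weight_def mult.assoc[symmetric] of_real_mult[symmetric] exp_add[symmetric] del: of_real_mult)
  have E: "smooth ?E" by (rule smooth_exp)
  have cE: "continuous_on UNIV ?E" by (intro continuous_intros)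
  have lh: "locally_integrable h" and lw: "locally_integrable (exp_weight c f)"
    using h by (auto simp: has_weak_derivative_def)
  show lf: "locally_integrable f"
    using locally_integrable_continuous_mult[OF cE lw] unfolding inv .
  have lEh: "locally_integrable (\<lambda>t. ?E t * h t)" by (rule locally_integrable_continuous_mult[OF cE lh])
  have lcf: "locally_integrable (\<lambda>t. of_real c * f t)"
    by (rule locally_integrable_continuous_mult[OF _ lf]) simp
  show "locally_integrable (\<lambda>t. ?E t * h t + of_real c * f t)"
    by (rule locally_integrable_add[OF lEh lcf])
  fix \<phi> assume \<phi>: "\<phi> \<in> test_functions"
  let ?\<psi> = "\<lambda>t. ?E t * \<phi> t"
  note i = locally_integrable_mult_test_function
  have \<psi>: "?\<psi> \<in> test_functions" by (rule test_function_mult[OF E \<phi>])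
  have "vderiv ?\<psi> t = ?E t * (vderiv \<phi> t + of_real c * \<phi> t)" for t
  proof -
    have "((\<lambda>t. exp (c * t)) has_real_derivative c * exp (c * t)) (at t)"
      by (auto intro!: derivative_eq_intros)
    then have "(?E has_vector_derivative of_real (c * exp (c * t))) (at t)"
      by (rule has_vector_derivative_of_real)
    from has_vector_derivative_mult[OF this smooth_has_vderiv[OF test_function_smooth[OF \<phi>], of t]]
    have "vderiv ?\<psi> t = ?E t * vderiv \<phi> t + of_real (c * exp (c * t)) * \<phi> t"
      by (rule vector_derivative_at)
    then show ?thesis by (simp add: algebra_simps)
  qed
  then have eq: "exp_weight c f t * vderiv ?\<psi> t = f t * vderiv \<phi> t + (of_real c * f t) * \<phi> t" for t
    by (simp add: inv[of t, symmetric] algebra_simps)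
  have "(LINT t|halfline. exp_weight c f t * vderiv ?\<psi> t) = - (LINT t|halfline. h t * ?\<psi> t)"
    using h \<psi> unfolding has_weak_derivative_def by blast
  then have "(LINT t|halfline. f t * vderiv \<phi> t + (of_real c * f t) * \<phi> t) = - (LINT t|halfline. h t * ?\<psi> t)"
    unfolding eq .
  moreover have "(LINT t|halfline. f t * vderiv \<phi> t + (of_real c * f t) * \<phi> t)
      = (LINT t|halfline. f t * vderiv \<phi> t) + (LINT t|halfline. (of_real c * f t) * \<phi> t)"
    by (intro Bochner_Integration.integral_add i lf lcf \<phi> test_function_vderiv)
  moreover have "(LINT t|halfline. (?E t * h t + of_real c * f t) * \<phi> t)
      = (LINT t|halfline. h t * ?\<psi> t) + (LINT t|halfline. (of_real c * f t) * \<phi> t)"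
  proof -
    have "(?E t * h t + of_real c * f t) * \<phi> t = (?E t * h t) * \<phi> t + (of_real c * f t) * \<phi> t" for t
      by (rule distrib_right)
    then have "(LINT t|halfline. (?E t * h t + of_real c * f t) * \<phi> t)
      = (LINT t|halfline. (?E t * h t) * \<phi> t) + (LINT t|halfline. (of_real c * f t) * \<phi> t)"
      by (simp only:) (intro Bochner_Integration.integral_add i lEh lcf \<phi>)
    moreover have "(?E t * h t) * \<phi> t = h t * ?\<psi> t" for t by (simp only: ac_simps)
    ultimately show ?thesis by simp
  qed
  ultimately show "(LINT t|halfline. f t * vderiv \<phi> t) = - (LINT t|halfline. (?E t * h t + of_real c * f t) * \<phi> t)"
    by (simp add: algebra_simps)
qed

lemma W11_weighted_space_weak_derivative:
  assumes "f \<in> W11_weighted_space c"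
  shows "has_weak_derivative f (weak_derivative f)"
proof -
  obtain h where "has_weak_derivative (exp_weight c f) h"
    using assms by (auto simp: W11_weighted_space_def W11_space_def)
  from has_weak_derivative_exp_weight[OF this] show ?thesis
    by (rule has_weak_derivative_weak_derivative)
qed

text \<open>
  The weak derivative is an arbitrary choice for each function, so its linearity holds only almost
  everywhere, by uniqueness.
\<close>

lemma weak_derivative_diff_test_function:
  assumes f: "f \<in> W11_weighted_space c" and \<phi>: "\<phi> \<in> test_functions"
  shows "AE t in halfline. weak_derivative (\<lambda>t. f t - \<phi> t) t = weak_derivative f t - vderiv \<phi> t"
proof -
  have d: "has_weak_derivative (\<lambda>t. f t - \<phi> t) (\<lambda>t. weak_derivative f t - vderiv \<phi> t)"
    by (intro has_weak_derivative_diff W11_weighted_space_weak_derivative[OF f] test_function_weak_derivative[OF \<phi>])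
  then have "has_weak_derivative (\<lambda>t. f t - \<phi> t) (weak_derivative (\<lambda>t. f t - \<phi> t))"
    by (rule has_weak_derivative_weak_derivative)
  then show ?thesis using d by (rule weak_derivative_unique)
qed

section \<open>Weighted norms and approximation by test functions\<close>

text \<open>
  The weighted \<open>L\<^sup>1\<close> norm with the trivial exponents removed.
\<close>

definition wnorm :: "real \<Rightarrow> (real \<Rightarrow> complex) \<Rightarrow> ennreal" where
  "wnorm c g = (\<integral>\<^sup>+t. ennreal (exp (- c * t) * norm (g t)) \<partial>halfline)"

lemma Lq_weighted_norm_1: "Lq_weighted_norm 1 c g = wnorm c g"
proof -
  have "ennreal_powr x (1 / 1) = x" for x
    by (cases x) (auto simp: ennreal_powr_def)
  then show ?thesis
    by (simp add: Lq_weighted_norm_def Lq_norm_def exp_weight_def norm_mult wnorm_def)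
qed

lemma W11_weighted_norm_eq: "W11_weighted_norm c f = wnorm c f + wnorm c (weak_derivative f)"
  by (simp add: W11_weighted_norm_def Lq_weighted_norm_1)

lemma continuous_halfline_measurable:
  fixes f :: "real \<Rightarrow> 'a::topological_space"
  shows "continuous_on UNIV f \<Longrightarrow> f \<in> borel_measurable halfline"
  by (intro measurable_restrict_space1 continuous_lebesgue_measurable)

lemma wnorm_measurable [measurable]:
  assumes [measurable]: "g \<in> borel_measurable halfline"
  shows "(\<lambda>t. ennreal (exp (- c * t) * norm (g t))) \<in> borel_measurable halfline"
proof -
  have [measurable]: "(\<lambda>t. exp (- c * t)) \<in> borel_measurable halfline"
    by (intro continuous_halfline_measurable continuous_intros)
  show ?thesis by measurable
qed

lemma wnorm_triangle:
  assumes u[measurable]: "u \<in> borel_measurable halfline" and v[measurable]: "v \<in> borel_measurable halfline"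
  shows "wnorm c u \<le> wnorm c v + wnorm c (\<lambda>t. v t - u t)"
proof -
  have "wnorm c u \<le> (\<integral>\<^sup>+t. ennreal (exp (- c * t) * norm (v t)) + ennreal (exp (- c * t) * norm (v t - u t)) \<partial>halfline)"
    unfolding wnorm_def
  proof (rule nn_integral_mono)
    fix t
    have "norm (u t) \<le> norm (v t) + norm (v t - u t)"
      using norm_triangle_sub[of "u t" "v t"] by (simp add: norm_minus_commute)
    then have "exp (- c * t) * norm (u t) \<le> exp (- c * t) * norm (v t) + exp (- c * t) * norm (v t - u t)"
      by (simp add: distrib_left[symmetric] mult_left_mono del: distrib_left)
    then show "ennreal (exp (- c * t) * norm (u t)) \<le> ennreal (exp (- c * t) * norm (v t)) + ennreal (exp (- c * t) * norm (v t - u t))"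
      by (simp flip: ennreal_plus)
  qed
  also have "\<dots> = wnorm c v + wnorm c (\<lambda>t. v t - u t)"
    unfolding wnorm_def by (intro nn_integral_add wnorm_measurable) measurable
  finally show ?thesis .
qed

lemma wnorm_minus_commute: "wnorm c (\<lambda>t. u t - v t) = wnorm c (\<lambda>t. v t - u t)"
  by (simp add: wnorm_def norm_minus_commute)

lemma halfline_nn_integral_continuous:
  fixes f :: "real \<Rightarrow> real"
  assumes cont: "continuous_on UNIV f" and nonneg: "\<And>t. 0 \<le> f t" and a: "0 < a"
    and supp: "\<forall>t. t \<notin> {a..b} \<longrightarrow> f t = 0"
  shows "(\<integral>\<^sup>+t. ennreal (f t) \<partial>halfline) = ennreal (LINT t|lborel. f t)"
proof -
  have "(\<integral>\<^sup>+t. ennreal (f t) \<partial>halfline) = (\<integral>\<^sup>+t. ennreal (f t) * indicator {0<..} t \<partial>lebesgue)"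
    by (rule nn_integral_restrict_space) simp
  also have "(\<lambda>t. ennreal (f t) * indicator {0<..} t) = (\<lambda>t. ennreal (f t))"
    using a supp by (auto simp: indicator_def fun_eq_iff)
  also have "(\<integral>\<^sup>+t. ennreal (f t) \<partial>lebesgue) = (\<integral>\<^sup>+t. ennreal (f t) \<partial>lborel)"
    by (rule nn_integral_completion)
  also have "\<dots> = ennreal (LINT t|lborel. f t)"
    using continuous_compact_support_integrable(1)[OF cont] supp nonneg
    by (intro nn_integral_eq_integral) auto
  finally show ?thesis .
qed

lemma wnorm_test_function:
  assumes \<phi>: "\<phi> \<in> test_functions"
  shows "wnorm c \<phi> = ennreal (LINT t|lborel. exp (- c * t) * norm (\<phi> t))"
proof -
  obtain a b where ab: "0 < a" "\<forall>t. t \<notin> {a..b} \<longrightarrow> \<phi> t = 0"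
    using \<phi> by (auto simp: test_functions_iff)
  then show ?thesis unfolding wnorm_def
    by (intro halfline_nn_integral_continuous[where a=a and b=b])
       (auto intro!: continuous_intros smooth_continuous test_function_smooth \<phi>)
qed

lemma laplace_transform_test_function:
  assumes \<phi>: "\<phi> \<in> test_functions"
  shows "laplace_transform \<phi> z = laplace \<phi> z"
  unfolding laplace_transform_def laplace_def
proof (rule halfline_integral_continuous)
  show "exp (- z * of_real t) * \<phi> t = 0" if "t \<le> 0" for t
    using \<phi> that by (force simp: test_functions_iff)
qed (intro continuous_intros smooth_continuous test_function_smooth \<phi>)

lemma laplace_transform_integrable:
  assumes g[measurable]: "g \<in> borel_measurable halfline" and fin: "wnorm c g < \<infinity>" and z: "c \<le> Re z"
  shows "integrable halfline (\<lambda>t. exp (- z * of_real t) * g t)"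
    and "ennreal (norm (laplace_transform g z)) \<le> wnorm c g"
proof -
  have em: "(\<lambda>t. exp (- z * of_real t)) \<in> borel_measurable halfline"
    by (intro continuous_halfline_measurable continuous_intros)
  have le: "(\<integral>\<^sup>+t. ennreal (norm (exp (- z * of_real t) * g t)) \<partial>halfline) \<le> wnorm c g"
    unfolding wnorm_def
  proof (rule nn_integral_mono)
    fix t assume "t \<in> space halfline"
    then have "0 < t" by (simp add: space_restrict_space)
    then have "c * t \<le> Re z * t" using z by (intro mult_right_mono) auto
    then show "ennreal (norm (exp (- z * of_real t) * g t)) \<le> ennreal (exp (- c * t) * norm (g t))"
      by (intro ennreal_leI) (auto simp: norm_mult intro!: mult_right_mono)
  qed
  show i: "integrable halfline (\<lambda>t. exp (- z * of_real t) * g t)"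
    using order.strict_trans1[OF le fin] by (intro integrableI_bounded borel_measurable_times em g)
  show "ennreal (norm (laplace_transform g z)) \<le> wnorm c g"
    unfolding laplace_transform_def using integral_norm_bound_ennreal[OF i] le by (rule order.trans)
qed

lemma W11_zero_space_measurable:
  assumes "f \<in> W11_weighted_zero_space c"
  shows "f \<in> borel_measurable halfline" "weak_derivative f \<in> borel_measurable halfline"
  using W11_weighted_space_weak_derivative[of f c] assms
  by (auto simp: W11_weighted_zero_space_def has_weak_derivative_def intro: locally_integrable_measurable)

lemma W11_zero_space_approx:
  assumes f: "f \<in> W11_weighted_zero_space c" and \<delta>: "0 < \<delta>"
  obtains \<phi> where "\<phi> \<in> test_functions"
    "wnorm c (\<lambda>t. f t - \<phi> t) + wnorm c (\<lambda>t. weak_derivative f t - vderiv \<phi> t) < ennreal \<delta>"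
proof -
  from f \<delta> obtain \<phi> where \<phi>: "\<phi> \<in> test_functions" "W11_weighted_norm c (\<lambda>t. f t - \<phi> t) < ennreal \<delta>"
    by (auto simp: W11_weighted_zero_space_def)
  have "AE t in halfline. weak_derivative (\<lambda>t. f t - \<phi> t) t = weak_derivative f t - vderiv \<phi> t"
    using f \<phi>(1) by (intro weak_derivative_diff_test_function) (auto simp: W11_weighted_zero_space_def)
  then have "wnorm c (weak_derivative (\<lambda>t. f t - \<phi> t)) = wnorm c (\<lambda>t. weak_derivative f t - vderiv \<phi> t)"
    unfolding wnorm_def by (intro nn_integral_cong_AE) (auto elim: eventually_mono)
  then show ?thesis using \<phi> by (intro that) (auto simp: W11_weighted_norm_eq)
qed

lemma test_function_measurable: "\<phi> \<in> test_functions \<Longrightarrow> \<phi> \<in> borel_measurable halfline"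
  by (intro continuous_halfline_measurable smooth_continuous test_function_smooth)

text \<open>
  One test function at finite distance is enough, since test functions have finite norms.
\<close>

lemma W11_zero_space_norm_finite:
  assumes f: "f \<in> W11_weighted_zero_space c"
  shows "wnorm c f < \<infinity>" "wnorm c (weak_derivative f) < \<infinity>"
proof -
  obtain \<phi> where \<phi>: "\<phi> \<in> test_functions"
    and d: "wnorm c (\<lambda>t. f t - \<phi> t) + wnorm c (\<lambda>t. weak_derivative f t - vderiv \<phi> t) < ennreal 1"
    using W11_zero_space_approx[OF f, of 1] by auto
  have d': "wnorm c (\<lambda>t. f t - \<phi> t) < \<infinity>" "wnorm c (\<lambda>t. weak_derivative f t - vderiv \<phi> t) < \<infinity>"
    using d by (auto intro: order.strict_trans1[OF _ order.strict_trans[OF d]])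
  note mf = W11_zero_space_measurable[OF f]
  have "wnorm c f \<le> wnorm c \<phi> + wnorm c (\<lambda>t. \<phi> t - f t)"
    by (intro wnorm_triangle mf test_function_measurable \<phi>)
  also have "\<dots> < \<infinity>" using d' by (simp add: wnorm_test_function[OF \<phi>] wnorm_minus_commute[of c \<phi>])
  finally show "wnorm c f < \<infinity>" .
  have "wnorm c (weak_derivative f) \<le> wnorm c (vderiv \<phi>) + wnorm c (\<lambda>t. vderiv \<phi> t - weak_derivative f t)"
    by (intro wnorm_triangle mf test_function_measurable test_function_vderiv \<phi>)
  also have "\<dots> < \<infinity>"
    using d' by (simp add: wnorm_test_function[OF test_function_vderiv[OF \<phi>]] wnorm_minus_commute[of c "vderiv \<phi>"])
  finally show "wnorm c (weak_derivative f) < \<infinity>" .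
qed

text \<open>
  A point of failure would entail failure on an interval of positive measure to its right.
\<close>

lemma AE_le_imp_le_continuous:
  fixes F :: "real \<Rightarrow> real"
  assumes ae: "AE s in lebesgue_on {c<..}. F s \<le> e" and F: "continuous_on UNIV F" and s: "c \<le> s"
  shows "F s \<le> e"
proof (rule ccontr)
  assume "\<not> F s \<le> e"
  then have "s \<in> {s. e < F s}" by simp
  moreover have "open {s. e < F s}" by (intro open_Collect_less continuous_on_const F)
  ultimately obtain r where r: "0 < r" "ball s r \<subseteq> {s. e < F s}"
    using openE by blast
  have "AE x in lebesgue. c < x \<longrightarrow> F x \<le> e" using ae by (subst (asm) AE_restrict_space_iff) auto
  then have "AE x in lebesgue. x \<notin> {s<..<s + r}"
  proof eventually_elim
    case (elim x)
    show ?case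
    proof
      assume x: "x \<in> {s<..<s + r}"
      then have "x \<in> ball s r" by (auto simp: dist_real_def)
      then show False using elim r x s by force
    qed
  qed
  then have "{s<..<s + r} \<in> null_sets lebesgue" by (subst AE_iff_null_sets) auto
  then show False using r by (simp add: null_sets_def)
qed

text \<open>
  The bound along the axis is available almost everywhere only; continuity of the transform of a test
  function turns it into a bound on all of \<open>[c,\<infinity>)\<close>, including the vertex of the triangle in
  \<open>two_constants_upper\<close>.
\<close>

lemma stability_test_function:
  assumes c: "0 \<le> c" and \<phi>: "\<phi> \<in> test_functions"
    and m: "wnorm c \<phi> + wnorm c (vderiv \<phi>) \<le> ennreal m" and e: "0 < e" "e < m"
    and axis: "AE s in lebesgue_on {c<..}. norm (laplace_transform \<phi> (of_real s)) \<le> e"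
  shows "(\<integral>\<^sup>+t. ennreal ((exp (- (c + 1) * t) * norm (\<phi> t))\<^sup>2) \<partial>halfline) \<le> ennreal (36 * m\<^sup>2 / sqrt (ln (m / e)))"
proof -
  obtain a b where ab: "0 < a" "a < b" and supp: "\<forall>t. t \<notin> {a<..<b} \<longrightarrow> \<phi> t = 0" "\<forall>t. t \<notin> {a<..<b} \<longrightarrow> vderiv \<phi> t = 0"
    using test_function_support[OF \<phi>] .
  note sm = test_function_smooth[OF \<phi>]
  have supp': "\<forall>t. t \<notin> {a..b} \<longrightarrow> \<phi> t = 0" using supp by auto
  have int0: "0 \<le> (LINT t|lborel. exp (- c * t) * norm (h t))" for h :: "real \<Rightarrow> complex"
    by (intro Bochner_Integration.integral_nonneg) auto
  have m': "(LINT t|lborel. exp (- c * t) * norm (\<phi> t)) + (LINT t|lborel. exp (- c * t) * norm (vderiv \<phi> t)) \<le> m"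
    using m e int0[of \<phi>] int0[of "vderiv \<phi>"]
    unfolding wnorm_test_function[OF \<phi>] wnorm_test_function[OF test_function_vderiv[OF \<phi>]]
    by (simp flip: ennreal_plus)
  have contL: "continuous_on UNIV (\<lambda>s. norm (laplace \<phi> (of_real s)))"
  proof -
    have "continuous_on UNIV (laplace \<phi>)"
      using laplace_holomorphic[OF smooth_continuous[OF sm] supp'] by (rule holomorphic_on_imp_continuous_on)
    then have "continuous_on UNIV (\<lambda>s. laplace \<phi> (complex_of_real s))"
      by (rule continuous_on_compose2) (simp_all add: continuous_on_of_real)
    then show ?thesis by (rule continuous_on_norm)
  qed
  have axis': "norm (laplace \<phi> (of_real s)) \<le> e" if "c \<le> s" for s
    using AE_le_imp_le_continuous[OF _ contL that] axis by (simp add: laplace_transform_test_function[OF \<phi>])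
  have "(LINT t|lborel. (exp (- (c + 1) * t) * norm (\<phi> t))\<^sup>2) \<le> 36 * m\<^sup>2 / sqrt (ln (m / e))"
    by (rule stability_smooth[OF c _ _ smooth_has_vderiv[OF sm] smooth_continuous[OF smooth_vderiv[OF sm]] supp m' e axis'])
       (use ab in auto)
  moreover have "(\<integral>\<^sup>+t. ennreal ((exp (- (c + 1) * t) * norm (\<phi> t))\<^sup>2) \<partial>halfline)
     = ennreal (LINT t|lborel. (exp (- (c + 1) * t) * norm (\<phi> t))\<^sup>2)"
    by (rule halfline_nn_integral_continuous[where a=a and b=b])
       (use ab supp' in \<open>auto intro!: continuous_intros smooth_continuous sm\<close>)
  ultimately show ?thesis by (simp add: ennreal_leI)
qed

lemma laplace_transform_diff_le:
  assumes f: "f \<in> W11_weighted_zero_space c" and \<phi>: "\<phi> \<in> test_functions" and z: "c \<le> Re z"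
  shows "ennreal (norm (laplace_transform f z - laplace_transform \<phi> z)) \<le> wnorm c (\<lambda>t. f t - \<phi> t)"
proof -
  note mf = W11_zero_space_measurable(1)[OF f] and m\<phi> = test_function_measurable[OF \<phi>]
  have fin: "wnorm c f < \<infinity>" "wnorm c \<phi> < \<infinity>"
    using W11_zero_space_norm_finite(1)[OF f] by (auto simp: wnorm_test_function[OF \<phi>])
  have "laplace_transform f z - laplace_transform \<phi> z = laplace_transform (\<lambda>t. f t - \<phi> t) z"
    unfolding laplace_transform_def right_diff_distrib
    by (intro Bochner_Integration.integral_diff[symmetric] laplace_transform_integrable(1)[OF _ _ z] mf m\<phi> fin)
  moreover have "ennreal (norm (laplace_transform (\<lambda>t. f t - \<phi> t) z)) \<le> wnorm c (\<lambda>t. f t - \<phi> t)"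
  proof (cases "wnorm c (\<lambda>t. f t - \<phi> t) < \<infinity>")
    case True
    then show ?thesis by (intro laplace_transform_integrable(2)[OF _ _ z]) (use mf m\<phi> in measurable)
  next
    case False
    then show ?thesis by (simp add: not_less top_unique)
  qed
  ultimately show ?thesis by simp
qed

section \<open>The estimate for general functions\<close>

text \<open>
  Convergence in the weighted norm yields convergence almost everywhere along a subsequence, and the
  rate \<open>1 / (n + 1)\<close> survives the passage to it.
\<close>

lemma W11_zero_space_approx_sequence:
  assumes f: "f \<in> W11_weighted_zero_space c"
  obtains \<phi> where "\<And>n. \<phi> n \<in> test_functions"
    "\<And>n. wnorm c (\<lambda>t. f t - \<phi> n t) + wnorm c (\<lambda>t. weak_derivative f t - vderiv (\<phi> n) t) < ennreal (1 / real (Suc n))"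
    "AE t in halfline. (\<lambda>n. \<phi> n t) \<longlonglongrightarrow> f t"
proof -
  have "\<exists>\<phi>. \<phi> \<in> test_functions \<and>
      wnorm c (\<lambda>t. f t - \<phi> t) + wnorm c (\<lambda>t. weak_derivative f t - vderiv \<phi> t) < ennreal (1 / real (Suc n))" for n
    using W11_zero_space_approx[OF f, of "1 / real (Suc n)"] by auto
  then obtain \<phi> where \<phi>: "\<And>n. \<phi> n \<in> test_functions"
    and d: "\<And>n. wnorm c (\<lambda>t. f t - \<phi> n t) + wnorm c (\<lambda>t. weak_derivative f t - vderiv (\<phi> n) t) < ennreal (1 / real (Suc n))"
    by metis
  have d1: "wnorm c (\<lambda>t. f t - \<phi> n t) < ennreal (1 / real (Suc n))" for n
    by (rule order.strict_trans1[OF _ d]) simp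
  let ?u = "\<lambda>n t. exp (- c * t) * norm (f t - \<phi> n t)"
  have [measurable]: "(\<lambda>t. exp (- c * t)) \<in> borel_measurable halfline"
    by (intro continuous_halfline_measurable continuous_intros)
  have [measurable]: "f \<in> borel_measurable halfline" "\<phi> n \<in> borel_measurable halfline" for n
    by (rule W11_zero_space_measurable[OF f], rule test_function_measurable[OF \<phi>])
  have u: "integrable halfline (?u n)" for n
  proof (rule integrableI_bounded)
    have "(\<integral>\<^sup>+t. ennreal (norm (?u n t)) \<partial>halfline) = wnorm c (\<lambda>t. f t - \<phi> n t)"
      by (simp add: wnorm_def)
    also have "\<dots> < \<infinity>" using order.strict_trans[OF d1 ennreal_less_top] by simp
    finally show "(\<integral>\<^sup>+t. ennreal (norm (?u n t)) \<partial>halfline) < \<infinity>" .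
  qed measurable
  have ule: "(LINT t|halfline. norm (?u n t)) \<le> 1 / real (Suc n)" for n
  proof -
    have "ennreal (LINT t|halfline. norm (?u n t)) = (\<integral>\<^sup>+t. ennreal (norm (?u n t)) \<partial>halfline)"
      by (intro nn_integral_eq_integral[symmetric] integrable_norm u) simp
    also have "\<dots> = wnorm c (\<lambda>t. f t - \<phi> n t)" by (simp add: wnorm_def)
    also have "\<dots> \<le> ennreal (1 / real (Suc n))" using d1[of n] by simp
    finally show ?thesis by (subst (asm) ennreal_le_iff) auto
  qed
  have "(\<lambda>n. LINT t|halfline. norm (?u n t)) \<longlonglongrightarrow> 0"
  proof (rule tendsto_sandwich)
    show "\<forall>\<^sub>F n in sequentially. (LINT t|halfline. norm (?u n t)) \<le> 1 / real (Suc n)"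
      using ule by simp
    show "\<forall>\<^sub>F n in sequentially. 0 \<le> (LINT t|halfline. norm (?u n t))"
      by (intro always_eventually allI Bochner_Integration.integral_nonneg) simp
    show "(\<lambda>n. 1 / real (Suc n)) \<longlonglongrightarrow> 0"
      by (rule LIMSEQ_inverse_real_of_nat[unfolded inverse_eq_divide])
  qed simp
  from tendsto_L1_AE_subseq[OF u this] obtain r :: "nat \<Rightarrow> nat"
    where r: "strict_mono r" and ae: "AE t in halfline. (\<lambda>n. ?u (r n) t) \<longlonglongrightarrow> 0" by blast
  show ?thesis
  proof (rule that[of "\<lambda>n. \<phi> (r n)"])
    show "\<phi> (r n) \<in> test_functions" for n by (rule \<phi>)
    show "wnorm c (\<lambda>t. f t - \<phi> (r n) t) + wnorm c (\<lambda>t. weak_derivative f t - vderiv (\<phi> (r n)) t) < ennreal (1 / real (Suc n))" for n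
    proof (rule order.strict_trans2[OF d])
      have "real (Suc n) \<le> real (Suc (r n))" using strict_mono_imp_increasing[OF r, of n] by simp
      then show "ennreal (1 / real (Suc (r n))) \<le> ennreal (1 / real (Suc n))"
        by (intro ennreal_leI divide_left_mono) auto
    qed
    show "AE t in halfline. (\<lambda>n. \<phi> (r n) t) \<longlonglongrightarrow> f t"
      using ae
    proof eventually_elim
      case (elim t)
      then have "(\<lambda>n. exp (c * t) * ?u (r n) t) \<longlonglongrightarrow> exp (c * t) * 0"
        by (intro tendsto_mult tendsto_const)
      then have "(\<lambda>n. norm (f t - \<phi> (r n) t)) \<longlonglongrightarrow> 0"
        by (simp add: mult.assoc[symmetric] exp_add[symmetric])
      then have "(\<lambda>n. f t - \<phi> (r n) t) \<longlonglongrightarrow> 0" by (rule tendsto_norm_zero_cancel)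
      from tendsto_diff[OF tendsto_const[of "f t"] this] show ?case by simp
    qed
  qed
qed

text \<open>
  The essential supremum of a non-measurable function is \<open>\<infinity>\<close> by definition, so measurability is what
  makes the bound of \<open>Linf_laplace_transform_le\<close> possible. It holds because the transform is the
  limit of those of test functions, which are continuous.
\<close>

lemma laplace_transform_measurable:
  assumes f: "f \<in> W11_weighted_zero_space c"
  shows "(\<lambda>s. laplace_transform f (of_real s)) \<in> borel_measurable (lebesgue_on {c<..})"
proof -
  obtain \<phi> where \<phi>: "\<And>n. \<phi> n \<in> test_functions" and d: "\<And>n. wnorm c (\<lambda>t. f t - \<phi> n t) + wnorm c (\<lambda>t. weak_derivative f t - vderiv (\<phi> n) t) < ennreal (1 / real (Suc n))"
    by (rule W11_zero_space_approx_sequence[OF f]) blast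
  show ?thesis
  proof (rule borel_measurable_LIMSEQ_metric)
    show "(\<lambda>s. laplace_transform (\<phi> n) (of_real s)) \<in> borel_measurable (lebesgue_on {c<..})" for n
    proof -
      obtain a b where "\<forall>t. t \<notin> {a..b} \<longrightarrow> \<phi> n t = 0" using \<phi>[of n] by (auto simp: test_functions_iff)
      then have "continuous_on UNIV (laplace (\<phi> n))"
        by (intro holomorphic_on_imp_continuous_on laplace_holomorphic smooth_continuous test_function_smooth \<phi>)
      then have "continuous_on UNIV (\<lambda>s. laplace (\<phi> n) (complex_of_real s))"
        by (rule continuous_on_compose2) (simp_all add: continuous_on_of_real)
      then show ?thesis
        unfolding laplace_transform_test_function[OF \<phi>]
        by (intro measurable_restrict_space1 continuous_lebesgue_measurable)
    qed
    fix s assume "s \<in> space (lebesgue_on {c<..})"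
    then have s: "c \<le> Re (of_real s)" by (simp add: space_restrict_space)
    have le: "norm (laplace_transform f (of_real s) - laplace_transform (\<phi> n) (of_real s)) \<le> 1 / real (Suc n)" for n
    proof -
      have "ennreal (norm (laplace_transform f (of_real s) - laplace_transform (\<phi> n) (of_real s))) \<le> wnorm c (\<lambda>t. f t - \<phi> n t)"
        by (rule laplace_transform_diff_le[OF f \<phi> s])
      also have "\<dots> \<le> wnorm c (\<lambda>t. f t - \<phi> n t) + wnorm c (\<lambda>t. weak_derivative f t - vderiv (\<phi> n) t)" by simp
      also have "\<dots> \<le> ennreal (1 / real (Suc n))" using d[of n] by simp
      finally show ?thesis by (subst (asm) ennreal_le_iff) auto
    qed
    have "(\<lambda>n. laplace_transform f (of_real s) - laplace_transform (\<phi> n) (of_real s)) \<longlonglongrightarrow> 0"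
      by (rule Lim_null_comparison[OF always_eventually[OF allI[OF le]]])
         (rule LIMSEQ_inverse_real_of_nat[unfolded inverse_eq_divide])
    from tendsto_diff[OF tendsto_const[of "laplace_transform f (of_real s)"] this]
    show "(\<lambda>n. laplace_transform (\<phi> n) (of_real s)) \<longlonglongrightarrow> laplace_transform f (of_real s)" by simp
  qed
qed

lemma Linf_laplace_transform_le:
  assumes f: "f \<in> W11_weighted_zero_space c"
  shows "Linf_norm_on {c<..} (\<lambda>s. laplace_transform f (of_real s)) \<le> wnorm c f"
  unfolding Linf_norm_on_def
proof (rule esssup_I)
  show "(\<lambda>s. ennreal (norm (laplace_transform f (of_real s)))) \<in> borel_measurable (lebesgue_on {c<..})"
    using laplace_transform_measurable[OF f] by measurable
  show "AE s in lebesgue_on {c<..}. ennreal (norm (laplace_transform f (of_real s))) \<le> wnorm c f"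
    by (intro AE_I2 laplace_transform_integrable(2) W11_zero_space_measurable[OF f] W11_zero_space_norm_finite[OF f])
       (simp add: space_restrict_space)
qed

text \<open>
  For \<open>\<phi>\<^sub>n\<close> the smooth estimate holds with \<open>m + \<delta>\<^sub>n\<close> and \<open>e + \<delta>\<^sub>n\<close>; Fatou's lemma gives the limit. The
  shift keeps the second bound positive, so the case \<open>e = 0\<close> is included: there the
  logarithm tends to infinity and \<open>f\<close> vanishes.
\<close>

proposition stability_squared:
  assumes c: "0 \<le> c" and f: "f \<in> W11_weighted_zero_space c"
    and m: "wnorm c f + wnorm c (weak_derivative f) = ennreal m"
    and e: "0 \<le> e" "e < m"
    and axis: "AE s in lebesgue_on {c<..}. norm (laplace_transform f (of_real s)) \<le> e"
  shows "(\<integral>\<^sup>+t. ennreal ((exp (- (c + 1) * t) * norm (f t))\<^sup>2) \<partial>halfline)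
     \<le> ennreal (if e = 0 then 0 else 36 * m\<^sup>2 / sqrt (ln (m / e)))"
proof -
  obtain \<phi> where \<phi>: "\<And>n. \<phi> n \<in> test_functions"
    and d: "\<And>n. wnorm c (\<lambda>t. f t - \<phi> n t) + wnorm c (\<lambda>t. weak_derivative f t - vderiv (\<phi> n) t) < ennreal (1 / real (Suc n))"
    and lim: "AE t in halfline. (\<lambda>n. \<phi> n t) \<longlonglongrightarrow> f t"
    using W11_zero_space_approx_sequence[OF f] by blast
  define \<delta> where "\<delta> n = 1 / real (Suc n)" for n
  have \<delta>0: "0 < \<delta> n" for n by (simp add: \<delta>_def)
  have d1: "wnorm c (\<lambda>t. f t - \<phi> n t) \<le> ennreal (\<delta> n)" for n
    by (rule order.trans[OF _ less_imp_le[OF d, folded \<delta>_def]]) simp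
  define B where "B n = 36 * (m + \<delta> n)\<^sup>2 / sqrt (ln ((m + \<delta> n) / (e + \<delta> n)))" for n
  let ?w = "\<lambda>u t. ennreal ((exp (- (c + 1) * t) * norm (u t))\<^sup>2)"
  have bound: "(\<integral>\<^sup>+t. ?w (\<phi> n) t \<partial>halfline) \<le> ennreal (B n)" for n
    unfolding B_def
  proof (rule stability_test_function[OF c \<phi>])
    note mf = W11_zero_space_measurable[OF f]
    have "wnorm c (\<phi> n) \<le> wnorm c f + wnorm c (\<lambda>t. f t - \<phi> n t)"
      by (intro wnorm_triangle mf test_function_measurable \<phi>)
    moreover have "wnorm c (vderiv (\<phi> n)) \<le> wnorm c (weak_derivative f) + wnorm c (\<lambda>t. weak_derivative f t - vderiv (\<phi> n) t)"
      by (intro wnorm_triangle mf test_function_measurable test_function_vderiv \<phi>)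
    ultimately have "wnorm c (\<phi> n) + wnorm c (vderiv (\<phi> n))
        \<le> (wnorm c f + wnorm c (\<lambda>t. f t - \<phi> n t)) + (wnorm c (weak_derivative f) + wnorm c (\<lambda>t. weak_derivative f t - vderiv (\<phi> n) t))"
      by (rule add_mono)
    also have "\<dots> = (wnorm c f + wnorm c (weak_derivative f)) + (wnorm c (\<lambda>t. f t - \<phi> n t) + wnorm c (\<lambda>t. weak_derivative f t - vderiv (\<phi> n) t))"
      by (simp only: ac_simps)
    also have "\<dots> \<le> ennreal m + ennreal (\<delta> n)"
      unfolding m using less_imp_le[OF d[of n], folded \<delta>_def] by (rule add_left_mono)
    also have "\<dots> = ennreal (m + \<delta> n)" using e \<delta>0[of n] by (simp add: less_imp_le)
    finally show "wnorm c (\<phi> n) + wnorm c (vderiv (\<phi> n)) \<le> ennreal (m + \<delta> n)" .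
    show "0 < e + \<delta> n" "e + \<delta> n < m + \<delta> n" using e \<delta>0[of n] by auto
    have "AE s in lebesgue_on {c<..}. s \<in> space (lebesgue_on {c<..})" by (rule AE_space)
    then show "AE s in lebesgue_on {c<..}. norm (laplace_transform (\<phi> n) (of_real s)) \<le> e + \<delta> n"
      using axis
    proof eventually_elim
      case (elim s)
      then have "c \<le> Re (of_real s)" by (simp add: space_restrict_space)
      then have "norm (laplace_transform f (of_real s) - laplace_transform (\<phi> n) (of_real s)) \<le> \<delta> n"
        using order.trans[OF laplace_transform_diff_le[OF f \<phi>] d1[of n]] \<delta>0[of n] by simp
      then show ?case
        using elim norm_triangle_sub[of "laplace_transform (\<phi> n) (of_real s)" "laplace_transform f (of_real s)"]
        by (simp add: norm_minus_commute)
    qed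
  qed
  have \<delta>lim: "\<delta> \<longlonglongrightarrow> 0" unfolding \<delta>_def[abs_def] by (rule LIMSEQ_inverse_real_of_nat[unfolded inverse_eq_divide])
  have Blim: "B \<longlonglongrightarrow> (if e = 0 then 0 else 36 * m\<^sup>2 / sqrt (ln (m / e)))"
  proof (cases "e = 0")
    case True
    have "(\<lambda>n. 36 * (m + 1 / real (Suc n))\<^sup>2 / sqrt (ln ((m + 1 / real (Suc n)) / (0 + 1 / real (Suc n))))) \<longlonglongrightarrow> 0"
      using e True by real_asymp
    then show ?thesis using True by (simp add: B_def[abs_def] \<delta>_def)
  next
    case False
    have "(\<lambda>n. 36 * (m + \<delta> n)\<^sup>2 / sqrt (ln ((m + \<delta> n) / (e + \<delta> n)))) \<longlonglongrightarrow> 36 * (m + 0)\<^sup>2 / sqrt (ln ((m + 0) / (e + 0)))"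
      using False e by (intro tendsto_intros \<delta>lim) auto
    then show ?thesis using False by (simp add: B_def[abs_def])
  qed
  have wm: "?w u \<in> borel_measurable halfline" if [measurable]: "u \<in> borel_measurable halfline" for u
  proof -
    have [measurable]: "(\<lambda>t. exp (- (c + 1) * t)) \<in> borel_measurable halfline"
      by (intro continuous_halfline_measurable continuous_intros)
    show ?thesis by measurable
  qed
  have "(\<integral>\<^sup>+t. ?w f t \<partial>halfline) = (\<integral>\<^sup>+t. liminf (\<lambda>n. ?w (\<phi> n) t) \<partial>halfline)"
    using lim
  proof (intro nn_integral_cong_AE, eventually_elim)
    case (elim t)
    then have "(\<lambda>n. ?w (\<phi> n) t) \<longlonglongrightarrow> ?w f t" by (intro tendsto_intros)
    then show ?case by (rule lim_imp_Liminf[symmetric, OF sequentially_bot])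
  qed
  also have "\<dots> \<le> liminf (\<lambda>n. \<integral>\<^sup>+t. ?w (\<phi> n) t \<partial>halfline)"
    by (intro nn_integral_liminf wm test_function_measurable \<phi>)
  also have "\<dots> \<le> liminf (\<lambda>n. ennreal (B n))"
    by (intro Liminf_mono always_eventually allI bound)
  also have "\<dots> = ennreal (if e = 0 then 0 else 36 * m\<^sup>2 / sqrt (ln (m / e)))"
    by (intro lim_imp_Liminf tendsto_ennrealI Blim) simp
  finally show ?thesis .
qed

text \<open>
  It remains to unfold the conventions on \<open>[0,\<infinity>]\<close>. Since \<open>0 < M < \<infinity>\<close> and \<open>\<epsilon> \<le> M\<close>, there are three
  cases: for \<open>\<epsilon> = M\<close> the right-hand side is \<open>\<infinity>\<close>, for \<open>\<epsilon> = 0\<close> the left-hand side is \<open>0\<close>, and for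
  \<open>0 < \<epsilon> < M\<close> the square root of \<open>stability_squared\<close> is the claim.
\<close>

theorem theorem2p1:
  fixes c :: real and f :: "real \<Rightarrow> complex" and M \<epsilon> :: ennreal
  assumes c: "c \<ge> 0"
    and f: "f \<in> W11_weighted_zero_space c"
    and f_nonzero: "\<not> (AE t in lebesgue_on {0<..}. f t = 0)"
    and M: "M = W11_weighted_norm c f"
    and \<epsilon>: "\<epsilon> = Linf_norm_on {c<..} (\<lambda>s. laplace_transform f (of_real s))"
  shows "Lq_weighted_norm 2 (c + 1) f
           \<le> ennreal (2 * (3 + c)) * M * (1 / ennreal_powr (ennreal_abs_ln (\<epsilon> / M)) (1 / 4))"
proof -
  have M': "M = wnorm c f + wnorm c (weak_derivative f)" by (simp add: M W11_weighted_norm_eq)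
  have "M < \<infinity>" using W11_zero_space_norm_finite[OF f] by (simp add: M')
  then obtain m where m0: "0 \<le> m" and m: "M = ennreal m" by (cases M) auto
  have "M \<noteq> 0"
  proof
    assume "M = 0"
    then have "wnorm c f = 0" by (simp add: M')
    then have "AE t in halfline. ennreal (exp (- c * t) * norm (f t)) = 0"
      unfolding wnorm_def by (subst (asm) nn_integral_0_iff_AE) (intro wnorm_measurable W11_zero_space_measurable[OF f])
    then have "AE t in halfline. f t = 0" by eventually_elim (simp add: ennreal_eq_0_iff mult_le_0_iff)
    then show False using f_nonzero by blast
  qed
  then have mpos: "0 < m" using m0 m by (cases "m = 0") auto
  have "\<epsilon> \<le> M" unfolding \<epsilon> M' using Linf_laplace_transform_le[OF f] by (rule order.trans) simp
  then obtain e where e0: "0 \<le> e" and e: "\<epsilon> = ennreal e" and em: "e \<le> m"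
    using m mpos by (cases \<epsilon>) (auto simp: top_unique)
  have ratio: "\<epsilon> / M = ennreal (e / m)" using e0 mpos by (simp add: e m divide_ennreal)
  define I where "I = (\<integral>\<^sup>+t. ennreal ((exp (- (c + 1) * t) * norm (f t))\<^sup>2) \<partial>halfline)"
  have L2: "Lq_weighted_norm 2 (c + 1) f = ennreal_powr I (1 / 2)"
    by (simp add: Lq_weighted_norm_def Lq_norm_def exp_weight_def norm_mult I_def)
  show ?thesis
  proof (cases "e = m")
    case True
    then have "ennreal_powr (ennreal_abs_ln (\<epsilon> / M)) (1 / 4) = 0"
      using mpos by (simp add: ratio ennreal_abs_ln_def ennreal_powr_def)
    then have "1 / ennreal_powr (ennreal_abs_ln (\<epsilon> / M)) (1 / 4) = \<infinity>"
      by (simp add: ennreal_divide_eq_top_iff)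
    moreover have "ennreal (2 * (3 + c)) * M \<noteq> 0"
      using c mpos m by (simp add: ennreal_eq_0_iff)
    ultimately show ?thesis by (simp add: ennreal_mult_top)
  next
    case False
    then have em': "e < m" using em by simp
    have "AE s in lebesgue_on {c<..}. ennreal (norm (laplace_transform f (of_real s))) \<le> ennreal e"
      unfolding e[symmetric] \<epsilon> Linf_norm_on_def by (rule esssup_AE)
    then have axis: "AE s in lebesgue_on {c<..}. norm (laplace_transform f (of_real s)) \<le> e"
      using e0 by simp
    define L where "L = ln (m / e)"
    have I: "I \<le> ennreal (if e = 0 then 0 else 36 * m\<^sup>2 / sqrt L)"
      unfolding I_def L_def by (rule stability_squared[OF c f _ e0 em' axis]) (simp add: M'[symmetric] m)
    show ?thesis
    proof (cases "e = 0")
      case True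
      then have "I = 0" using I by simp
      then show ?thesis by (simp add: L2 ennreal_powr_def)
    next
      case False
      then have epos: "0 < e" using e0 by simp
      have L: "0 < L" using epos em' by (simp add: L_def)
      have "ln (e / m) = - L" using epos mpos by (simp add: L_def ln_div)
      then have ln: "ennreal_abs_ln (\<epsilon> / M) = ennreal L"
        using L epos mpos by (simp add: ratio ennreal_abs_ln_def)
      have inv: "1 / ennreal_powr (ennreal L) (1 / 4) = ennreal (1 / L powr (1 / 4))"
        using L by (simp add: ennreal_powr_def divide_ennreal flip: ennreal_1)
      have mult3: "ennreal a * ennreal m * ennreal b = ennreal (a * m * b)" if "0 \<le> a" "0 \<le> b" for a b
        using that m0 by (simp add: ennreal_mult)
      have rhs: "ennreal (2 * (3 + c)) * M * (1 / ennreal_powr (ennreal_abs_ln (\<epsilon> / M)) (1 / 4))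
          = ennreal (2 * (3 + c) * m * (1 / L powr (1 / 4)))"
        unfolding ln inv unfolding m using c by (intro mult3) auto
      obtain x where x0: "0 \<le> x" and x: "I = ennreal x"
        using I False by (cases I) (auto simp: top_unique)
      have xle: "x \<le> 36 * m\<^sup>2 / sqrt L"
        using I False x0 L unfolding x by (simp add: ennreal_le_iff)
      have "(L powr (1 / 4))\<^sup>2 = sqrt L"
        using L by (simp add: powr_half_sqrt[symmetric] power2_eq_square powr_add[symmetric])
      then have "36 * m\<^sup>2 / sqrt L = (6 * m / L powr (1 / 4))\<^sup>2"
        by (simp add: power_divide power_mult_distrib)
      then have "sqrt x \<le> 6 * m / L powr (1 / 4)"
        using xle mpos by (intro real_le_lsqrt) auto
      also have "\<dots> \<le> 2 * (3 + c) * m * (1 / L powr (1 / 4))"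
        using c mpos by (simp add: divide_right_mono)
      finally have "sqrt x \<le> 2 * (3 + c) * m * (1 / L powr (1 / 4))" .
      moreover have "ennreal_powr I (1 / 2) = ennreal (sqrt x)"
        using x0 by (simp add: x ennreal_powr_def powr_half_sqrt)
      ultimately show ?thesis unfolding L2 rhs by (simp add: ennreal_leI)
    qed
  qed
qed

end
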